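(* Let $A,B\in M_{n\times n}(\mathbb{C})$ be self-adjoint with $A\geq B\geq 0$. Then $$\|A+B\|_p^p+\|A-B\|_p^p\;\geq\; \|\sigma(A)+\sigma(B)\|_p^p+\|\sigma(A)-\sigma(B)\|_p^p$$ for $1\leq p\leq 2$, with the inequality reversing for $2\leq p\leq 3$. There is equality for some $p\in[1,3]$ with $p\neq 1,2$ if and only if there is equality for every $p$ in the entire range $1\leq p\leq 3$.
   Context: For self-adjoint matrices, $A\ge B$ means that $A-B$ is positive semidefinite. For a matrix $X\in M_{n\times n}(\mathbb{C})$, $\|X\|_p=\operatorname{Tr}[(X^*X)^{p/2}]^{1/p}$ is the $p$-Schatten norm; for a vector $v\in\mathbb{R}^n$, $\|v\|_p=(\sum_i|v_i|^p)^{1/p}$. $\sigma(X)\in\mathbb{R}^n$ denotes the vector of singular values of $X$ (with multiplicity) in decreasing order. *)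

theory Defs
  imports
    "Jordan_Normal_Form.Schur_Decomposition"
    "HOL-Library.Multiset"
begin

definition hermitian_mat :: "complex mat \<Rightarrow> bool" where
  "hermitian_mat A \<longleftrightarrow> square_mat A \<and> mat_adjoint A = A"

definition psd_mat :: "complex mat \<Rightarrow> bool" where
  "psd_mat A \<longleftrightarrow> hermitian_mat A \<and> (\<forall>v \<in> carrier_vec (dim_row A). (A *\<^sub>v v) \<bullet>c v \<ge> 0)"

definition unitary_mat :: "complex mat \<Rightarrow> bool" where
  "unitary_mat U \<longleftrightarrow> square_mat U \<and> mat_adjoint U * U = 1\<^sub>m (dim_row U)"

definition mat_trace :: "complex mat \<Rightarrow> complex" where
  "mat_trace A = (\<Sum>i<dim_row A. A $$ (i, i))"

(* Functional calculus: if A = U diag(d) U^* with U unitary and d real, then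
   f(A) = U diag(f o d) U^*.  For Hermitian A such U and d exist, and the result does not
   depend on them, so the choice operator only names the one matrix f(A). *)
definition mat_fun :: "(real \<Rightarrow> real) \<Rightarrow> complex mat \<Rightarrow> complex mat" where
  "mat_fun f A = (SOME C. \<exists>U (d :: nat \<Rightarrow> real).
     U \<in> carrier_mat (dim_row A) (dim_row A) \<and> unitary_mat U \<and>
     A = U * mat_diag (dim_row A) (\<lambda>i. complex_of_real (d i)) * mat_adjoint U \<and>
     C = U * mat_diag (dim_row A) (\<lambda>i. complex_of_real (f (d i))) * mat_adjoint U)"

(* Meant for positive semidefinite A and r > 0; note that 0 powr r = 0. *)
definition mat_powr :: "complex mat \<Rightarrow> real \<Rightarrow> complex mat" where
  "mat_powr A r = mat_fun (\<lambda>x. x powr r) A"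

(* The trace below is a nonnegative real, so taking the real part loses nothing. *)
definition schatten_norm :: "real \<Rightarrow> complex mat \<Rightarrow> real" where
  "schatten_norm p X = Re (mat_trace (mat_powr (mat_adjoint X * X) (p / 2))) powr (1 / p)"

definition vec_pnorm :: "real \<Rightarrow> real vec \<Rightarrow> real" where
  "vec_pnorm p v = (\<Sum>i<dim_vec v. \<bar>v $ i\<bar> powr p) powr (1 / p)"

(* Square roots of the eigenvalues of X^* X, repeated according to their multiplicity as
   roots of the characteristic polynomial, in decreasing order.  These eigenvalues are
   nonnegative reals. *)
definition singular_values :: "complex mat \<Rightarrow> real vec" where
  "singular_values X = vec_of_list (rev (sorted_list_of_multiset
     (image_mset (\<lambda>z. sqrt (Re z)) (proots (char_poly (mat_adjoint X * X))))))"

end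

theory Submission
  imports Defs "Jordan_Normal_Form.Spectral_Radius"
begin

text \<open>
  In an eigenbasis of \<open>A\<close> write \<open>A = diag(a)\<close>, and let \<open>b\<close> be the ordered eigenvalues of \<open>B\<close>. For
  \<open>f(t) = c t\<^sup>e\<close> with \<open>e \<le> 3\<close> and \<open>c e (e - 1) (e - 2) \<le> 0\<close> we have
  \<open>tr f(A + B) + tr f(A - B) \<ge> \<Sum>\<^sub>i f(a\<^sub>i + b\<^sub>i) + f(a\<^sub>i - b\<^sub>i)\<close>, by induction on the dimension:
  deform \<open>A\<close> along \<open>A(s) = C - s (C - A)\<close>, where \<open>C\<close> is the largest eigenvalue of \<open>A\<close>. At \<open>s = 0\<close>
  there is equality. The function \<open>g = - f'\<close> is convex and belongs to the same class of powers.
  By Abel summation the derivative of the left-hand side is a positive combination of partial traces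
  of \<open>g(A(s) + B) + g(A(s) - B)\<close> over leading blocks of size \<open>r < n\<close>, the eigenspaces of the smallest
  eigenvalues of \<open>A\<close>. By Jensen's inequality a partial trace is at least \<open>tr g\<close> of the compressions,
  to which the induction hypothesis applies; by Cauchy interlacing and convexity of \<open>g\<close>
  the compression of \<open>B\<close> may then be replaced by the \<open>r\<close> smallest \<open>b\<^sub>i\<close>, which gives the derivative of
  the right-hand side. If equality holds at \<open>s = 1\<close>, it holds along the path, and strict convexity of
  \<open>g\<close> forces \<open>B\<close> to commute with \<open>A\<close>, with matching order of the eigenvalues.
\<close>

text \<open>The sign condition says \<open>f''' \<le> 0\<close>, that is, \<open>- f'\<close> is
  convex. Passing from \<open>(c, e)\<close> to \<open>(- c * e, e - 1)\<close> multiplies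
  \<open>c * e * (e - 1) * (e - 2)\<close> by \<open>3 - e\<close>, so the sign persists for
  exponents up to 3: this is where the bound 3 comes from, and the factor \<open>e - 2\<close> is
  why the inequality turns round at 2. The price is that exponents drop by one with each descent and
  become negative, where powers are singular at 0. Hence the induction runs under a uniform bound
  \<open>l > 0\<close> on \<open>A - B\<close>, and the semidefinite case is a limit for
  \<open>e > 0\<close>. Strictness does not survive that limit, so equality is analysed by one
  descent directly at \<open>l = 0\<close>, legitimate since then \<open>e > 1\<close> and
  \<open>g\<close> still has a positive exponent. No trace function is differentiated: tangent
  inequalities between two points of the path stand in for derivatives, and the cases of convex and
  concave \<open>f\<close> exchange the endpoints.\<close>

section \<open>Convexity of powers\<close>

lemma powr_tangent_strict:
  fixes c e x \<xi> :: real
  assumes K: "0 < c * e * (e - 1)" and \<xi>: "0 < \<xi>" and x: "0 \<le> x" "x \<noteq> \<xi>"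
    and e: "0 < x \<or> 0 < e"
  shows "c * \<xi> powr e + c * e * \<xi> powr (e - 1) * (x - \<xi>) < c * x powr e"
proof (cases "x = 0")
  case True
  \<comment> \<open>At \<open>x = 0\<close> the tangent has height
    \<open>c * (1 - e) * \<xi> powr e\<close>, which is negative: here \<open>e\<close> is positive,
    so \<open>K\<close> forces \<open>c * (e - 1) > 0\<close>. The mean value argument below needs
    \<open>x > 0\<close>.\<close>
  have "\<xi> powr (e - 1) * \<xi> = \<xi> powr e"
    using \<xi> by (simp add: powr_diff)
  then have "c * \<xi> powr e + c * e * \<xi> powr (e - 1) * (x - \<xi>) = (c - c * e) * \<xi> powr e"
    using True by (simp add: algebra_simps)
  moreover have "c - c * e < 0"
  proof -
    have "0 < e" using e True by simp
    moreover have "0 < e * (c * (e - 1))" using K by (simp add: mult_ac)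
    ultimately have "0 < c * (e - 1)" using zero_less_mult_pos by blast
    then show ?thesis by (simp add: algebra_simps)
  qed
  ultimately show ?thesis
    using True \<xi> by (simp add: mult_neg_pos)
next
  case False
  with x have x0: "0 < x" by simp
  have mono: "c * e * u powr (e - 1) < c * e * v powr (e - 1)" if "0 < u" "u < v" for u v
  proof (rule DERIV_pos_imp_increasing[OF that(2)])
    fix z assume "u \<le> z" "z \<le> v"
    then have z: "0 < z" using that by simp
    have "((\<lambda>z. c * e * z powr (e - 1)) has_real_derivative c * e * ((e - 1) * z powr (e - 1 - 1))) (at z)"
      using z by (auto intro!: derivative_eq_intros)
    moreover have "0 < c * e * ((e - 1) * z powr (e - 1 - 1))"
      using K z by (simp add: mult.assoc[symmetric])
    ultimately show "\<exists>y. ((\<lambda>z. c * e * z powr (e - 1)) has_real_derivative y) (at z) \<and> 0 < y"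
      by blast
  qed
  have d: "((\<lambda>z. c * z powr e) has_real_derivative c * e * z powr (e - 1)) (at z)" if "0 < z" for z
    using that by (auto intro!: derivative_eq_intros)
  consider "x < \<xi>" | "\<xi> < x" using x by linarith
  then show ?thesis
  proof cases
    case 1
    obtain z where z: "x < z" "z < \<xi>"
      "c * \<xi> powr e - c * x powr e = (\<xi> - x) * (c * e * z powr (e - 1))"
      using MVT2[OF 1, of "\<lambda>z. c * z powr e" "\<lambda>z. c * e * z powr (e - 1)"] d x0 by auto
    have "(\<xi> - x) * (c * e * z powr (e - 1)) < (\<xi> - x) * (c * e * \<xi> powr (e - 1))"
      by (rule mult_strict_left_mono[OF mono]) (use z x0 1 in auto)
    with z(3) show ?thesis by (simp add: algebra_simps)
  next
    case 2
    obtain z where z: "\<xi> < z" "z < x"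
      "c * x powr e - c * \<xi> powr e = (x - \<xi>) * (c * e * z powr (e - 1))"
      using MVT2[OF 2, of "\<lambda>z. c * z powr e" "\<lambda>z. c * e * z powr (e - 1)"] d \<xi> by auto
    have "(x - \<xi>) * (c * e * \<xi> powr (e - 1)) < (x - \<xi>) * (c * e * z powr (e - 1))"
      by (rule mult_strict_left_mono[OF mono]) (use z \<xi> 2 in auto)
    with z(3) show ?thesis by (simp add: algebra_simps)
  qed
qed

lemma powr_tangent:
  fixes c e x \<xi> :: real
  assumes K: "0 \<le> c * e * (e - 1)" and \<xi>: "0 < \<xi>" and x: "0 \<le> x" and e: "0 < x \<or> 0 < e"
  shows "c * \<xi> powr e + c * e * \<xi> powr (e - 1) * (x - \<xi>) \<le> c * x powr e"
proof -
  consider "x = \<xi>" | "x \<noteq> \<xi>" "0 < c * e * (e - 1)" | "c = 0" | "e = 0" | "e = 1"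
    using K by (auto simp: less_le)
  then show ?thesis
  proof cases
    case 2
    then show ?thesis using powr_tangent_strict[of c e \<xi> x] assms by auto
  qed (use assms in \<open>auto simp: algebra_simps\<close>)
qed

text \<open>The tangent may also touch at \<open>\<xi> = 0\<close> if \<open>e > 1\<close>: then
  \<open>0 powr (e - 1) = 0\<close> is the true one-sided slope, and only \<open>c \<ge> 0\<close>
  remains to be seen. Semidefinite matrices need this case.\<close>

lemma powr_tangent_closed:
  fixes c e x \<xi> :: real
  assumes K: "0 \<le> c * e * (e - 1)" and \<xi>: "0 \<le> \<xi>" and x: "0 \<le> x"
    and e: "(0 < \<xi> \<and> 0 < x) \<or> 1 < e"
  shows "c * \<xi> powr e + c * e * \<xi> powr (e - 1) * (x - \<xi>) \<le> c * x powr e"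
proof (cases "\<xi> = 0")
  case True
  with e have "1 < e" by auto
  then have "0 < e * (e - 1)" by simp
  then have "0 \<le> c" using K by (simp add: mult.assoc zero_le_mult_iff)
  then show ?thesis using True by simp
next
  case False
  then show ?thesis using powr_tangent[of c e \<xi> x] assms by auto
qed

text \<open>The tangent at the mean \<open>\<xi>\<close> is averaged against the weights; equality
  then forces equality in every tangent inequality of positive weight. Mean 0 is treated apart, as
  there is no tangent to use: every point of positive weight is then 0.\<close>

lemma powr_jensen:
  fixes c e :: real and p x :: "'a \<Rightarrow> real"
  assumes fin: "finite I" and K: "0 \<le> c * e * (e - 1)"
    and p: "\<And>k. k \<in> I \<Longrightarrow> 0 \<le> p k" "sum p I = 1"
    and x: "\<And>k. k \<in> I \<Longrightarrow> 0 \<le> x k" and e: "(\<forall>k\<in>I. 0 < x k) \<or> 0 < e"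
  shows "c * (\<Sum>k\<in>I. p k * x k) powr e \<le> (\<Sum>k\<in>I. p k * (c * x k powr e))"
    and "0 < c * e * (e - 1) \<Longrightarrow>
      (\<Sum>k\<in>I. p k * (c * x k powr e)) = c * (\<Sum>k\<in>I. p k * x k) powr e \<Longrightarrow>
      k \<in> I \<Longrightarrow> p k = 0 \<or> x k = (\<Sum>k\<in>I. p k * x k)"
proof -
  define \<xi> where "\<xi> = (\<Sum>k\<in>I. p k * x k)"
  define m where "m = c * e * \<xi> powr (e - 1)"
  have \<xi>0: "0 \<le> \<xi>" unfolding \<xi>_def using p x by (auto intro!: sum_nonneg)
  have lin: "(\<Sum>k\<in>I. p k * (c * \<xi> powr e + m * (x k - \<xi>))) = c * \<xi> powr e"
  proof -
    have "(\<Sum>k\<in>I. p k * (c * \<xi> powr e + m * (x k - \<xi>)))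
        = (\<Sum>k\<in>I. p k * (c * \<xi> powr e - m * \<xi>) + m * (p k * x k))"
      by (intro sum.cong) (auto simp: algebra_simps)
    also have "\<dots> = sum p I * (c * \<xi> powr e - m * \<xi>) + m * \<xi>"
      by (simp add: sum.distrib sum_distrib_right sum_distrib_left \<xi>_def)
    finally show ?thesis using p by simp
  qed
  have zero: "p k * x k = 0" if "\<xi> = 0" "k \<in> I" for k
    using that sum_nonneg_eq_0_iff[OF fin, of "\<lambda>k. p k * x k"] p x by (auto simp: \<xi>_def)
  have tang: "c * \<xi> powr e + m * (x k - \<xi>) \<le> c * x k powr e" if "0 < \<xi>" "k \<in> I" for k
    unfolding m_def using powr_tangent[OF K that(1) x[OF that(2)]] e that by auto
  have zero_e: "0 < e" if "\<xi> = 0"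
  proof (rule ccontr)
    assume "\<not> 0 < e"
    with e have "\<forall>k\<in>I. 0 < x k" by auto
    with zero[OF that] have "\<And>k. k \<in> I \<Longrightarrow> p k = 0" by force
    with p(2) show False by simp
  qed
  have case0: "p k * (c * x k powr e) = 0" if "\<xi> = 0" "k \<in> I" for k
    using zero[OF that] zero_e[OF that(1)] by auto
  show "c * (\<Sum>k\<in>I. p k * x k) powr e \<le> (\<Sum>k\<in>I. p k * (c * x k powr e))"
  proof (cases "\<xi> = 0")
    case True
    then show ?thesis using case0[OF True] by (simp add: \<xi>_def[symmetric])
  next
    case False
    with \<xi>0 have "0 < \<xi>" by simp
    then have "(\<Sum>k\<in>I. p k * (c * \<xi> powr e + m * (x k - \<xi>))) \<le> (\<Sum>k\<in>I. p k * (c * x k powr e))"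
      using tang p by (intro sum_mono mult_left_mono) auto
    then show ?thesis unfolding lin by (simp add: \<xi>_def)
  qed
  assume K': "0 < c * e * (e - 1)" and k: "k \<in> I"
    and eq: "(\<Sum>k\<in>I. p k * (c * x k powr e)) = c * (\<Sum>k\<in>I. p k * x k) powr e"
  show "p k = 0 \<or> x k = (\<Sum>k\<in>I. p k * x k)"
  proof (cases "\<xi> = 0")
    case True
    then show ?thesis using zero[OF True k] by (auto simp: \<xi>_def[symmetric])
  next
    case False
    with \<xi>0 have pos: "0 < \<xi>" by simp
    have "(\<Sum>k\<in>I. p k * (c * x k powr e) - p k * (c * \<xi> powr e + m * (x k - \<xi>))) = 0"
      using eq lin by (simp add: sum_subtractf \<xi>_def)
    moreover have "0 \<le> p k * (c * x k powr e) - p k * (c * \<xi> powr e + m * (x k - \<xi>))"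
      if "k \<in> I" for k
      using mult_left_mono[OF tang[OF pos that] p(1)[OF that]] by simp
    ultimately have "p k * (c * x k powr e) - p k * (c * \<xi> powr e + m * (x k - \<xi>)) = 0"
      using sum_nonneg_eq_0_iff[OF fin,
          of "\<lambda>k. p k * (c * x k powr e) - p k * (c * \<xi> powr e + m * (x k - \<xi>))"] k
      by blast
    then have "p k = 0 \<or> c * x k powr e = c * \<xi> powr e + m * (x k - \<xi>)"
      by auto
    moreover have "c * \<xi> powr e + m * (x k - \<xi>) < c * x k powr e" if "x k \<noteq> \<xi>"
      unfolding m_def using powr_tangent_strict[OF K' pos x[OF k] that] e k by auto
    ultimately show ?thesis unfolding \<xi>_def[symmetric] by auto
  qed
qed

text \<open>Both \<open>a + b\<close> and \<open>a - b\<close> are convex combinations of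
  \<open>a + \<beta>\<close> and \<open>a - \<beta>\<close>, with the weights \<open>t\<close> and
  \<open>1 - t\<close> in opposite order, so two applications of Jensen's inequality on a two-point
  set add up to the claim.\<close>

lemma powr_even_part_mono:
  fixes a b \<beta> c e :: real
  assumes K: "0 \<le> c * e * (e - 1)" and b: "0 \<le> b" "b \<le> \<beta>" "\<beta> \<le> a" and e: "\<beta> < a \<or> 0 < e"
  shows "c * (a + b) powr e + c * (a - b) powr e \<le> c * (a + \<beta>) powr e + c * (a - \<beta>) powr e"
    and "0 < c * e * (e - 1) \<Longrightarrow>
      c * (a + b) powr e + c * (a - b) powr e = c * (a + \<beta>) powr e + c * (a - \<beta>) powr e \<Longrightarrow>
      b = \<beta>"
proof -
  have main: "c * (a + b) powr e + c * (a - b) powr e \<le> c * (a + \<beta>) powr e + c * (a - \<beta>) powr e \<and>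
    (0 < c * e * (e - 1) \<longrightarrow>
      c * (a + b) powr e + c * (a - b) powr e \<noteq> c * (a + \<beta>) powr e + c * (a - \<beta>) powr e)"
    if "b < \<beta>"
  proof -
    have \<beta>: "0 < \<beta>" using that b by simp
    define t where "t = (\<beta> + b) / (2 * \<beta>)"
    have t: "0 < t" "t < 1" unfolding t_def using \<beta> b that by (auto simp: field_simps)
    have tb: "2 * (t * \<beta>) = \<beta> + b" unfolding t_def using \<beta> by (simp add: field_simps)
    define x where "x = (\<lambda>i::bool. if i then a + \<beta> else a - \<beta>)"
    define p where "p = (\<lambda>i::bool. if i then t else 1 - t)"
    define q where "q = (\<lambda>i::bool. if i then 1 - t else t)"
    have xs: "\<And>k. 0 \<le> x k" "(\<forall>k\<in>UNIV. 0 < x k) \<or> 0 < e"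
      unfolding x_def using b e \<beta> by auto
    have pq: "\<And>k. 0 \<le> p k" "sum p UNIV = 1" "\<And>k. 0 \<le> q k" "sum q UNIV = 1"
      unfolding p_def q_def using t by (auto simp: UNIV_bool)
    have mp: "(\<Sum>k\<in>UNIV. p k * x k) = a + b"
      unfolding UNIV_bool p_def x_def using tb by (simp add: algebra_simps)
    have mq: "(\<Sum>k\<in>UNIV. q k * x k) = a - b"
      unfolding UNIV_bool q_def x_def using tb by (simp add: algebra_simps)
    have s: "(\<Sum>k\<in>UNIV. p k * (c * x k powr e)) + (\<Sum>k\<in>UNIV. q k * (c * x k powr e))
        = c * (a + \<beta>) powr e + c * (a - \<beta>) powr e"
      unfolding UNIV_bool p_def q_def x_def by (simp add: algebra_simps)
    note jp = powr_jensen[OF finite K pq(1,2) xs, unfolded mp]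
    note jq = powr_jensen[OF finite K pq(3,4) xs, unfolded mq]
    have "(\<Sum>k\<in>UNIV. p k * (c * x k powr e)) \<noteq> c * (a + b) powr e" if "0 < c * e * (e - 1)"
    proof
      assume "(\<Sum>k\<in>UNIV. p k * (c * x k powr e)) = c * (a + b) powr e"
      then have "p True = 0 \<or> x True = a + b" using jp(2)[OF that] by blast
      then show False using t \<open>b < \<beta>\<close> by (auto simp: p_def x_def)
    qed
    then show ?thesis using jp(1) jq(1) s by (smt (verit, best))
  qed
  show "c * (a + b) powr e + c * (a - b) powr e \<le> c * (a + \<beta>) powr e + c * (a - \<beta>) powr e"
    using main b by (cases "b = \<beta>") auto
  assume "0 < c * e * (e - 1)"
    "c * (a + b) powr e + c * (a - b) powr e = c * (a + \<beta>) powr e + c * (a - \<beta>) powr e"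
  then show "b = \<beta>" using main b by (cases "b < \<beta>") auto
qed

section \<open>Monotonicity from finite differences, and summation by parts\<close>

text \<open>
  Over a partition into \<open>N\<close> equal intervals the losses telescope to \<open>O(1/N)\<close>, whatever \<open>\<rho>\<close> is.
\<close>

lemma nondecreasing_if_small_losses:
  fixes G \<rho> :: "real \<Rightarrow> real"
  assumes "u \<le> v"
    and G: "\<And>s t. u \<le> s \<Longrightarrow> s \<le> t \<Longrightarrow> t \<le> v \<Longrightarrow> (t - s) * (\<rho> s - \<rho> t) \<le> G t - G s"
  shows "G u \<le> G v"
proof -
  have part: "(v - u) * (\<rho> u - \<rho> v) / real N \<le> G v - G u" if N: "0 < N" for N
  proof -
    define h where "h = (v - u) / real N"
    define s where "s = (\<lambda>i. u + real i * h)"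
    have h: "0 \<le> h" "h * real N = v - u" unfolding h_def using N assms(1) by auto
    have "(\<Sum>i<N. h * (\<rho> (s i) - \<rho> (s (Suc i)))) \<le> (\<Sum>i<N. G (s (Suc i)) - G (s i))"
    proof (rule sum_mono)
      fix i assume "i \<in> {..<N}"
      then have "real (Suc i) * h \<le> real N * h" using h by (intro mult_right_mono) auto
      then have le: "s (Suc i) \<le> v" using h by (simp add: s_def algebra_simps)
      have d: "s (Suc i) - s i = h" by (simp add: s_def algebra_simps)
      show "h * (\<rho> (s i) - \<rho> (s (Suc i))) \<le> G (s (Suc i)) - G (s i)"
        using G[of "s i" "s (Suc i)"] le d h by (simp add: s_def)
    qed
    moreover have "(\<Sum>i<N. G (s (Suc i)) - G (s i)) = G (s N) - G (s 0)"
      by (rule sum_lessThan_telescope)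
    moreover have "(\<Sum>i<N. h * (\<rho> (s i) - \<rho> (s (Suc i)))) = h * (\<rho> (s 0) - \<rho> (s N))"
      by (simp only: sum_distrib_left[symmetric] sum_lessThan_telescope'[of "\<lambda>i. \<rho> (s i)"])
    moreover have "s 0 = u" "s N = v" using h by (auto simp: s_def algebra_simps)
    ultimately show ?thesis by (simp add: h_def)
  qed
  have "(\<lambda>N. (v - u) * (\<rho> u - \<rho> v) / real N) \<longlonglongrightarrow> 0"
    by (rule lim_const_over_n)
  then have "0 \<le> G v - G u"
    using part by (intro LIMSEQ_le_const2[of _ 0]) (auto intro!: exI[of _ 1])
  then show ?thesis by simp
qed

text \<open>The term \<open>i = m\<close> has weight 0, so only leading blocks of size at most
  \<open>m\<close> occur. This is what lets an induction on the dimension handle a sum of length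
  \<open>Suc m\<close>.\<close>

lemma abel_summation:
  fixes a w :: "nat \<Rightarrow> 'a::comm_ring"
  shows "(\<Sum>i<Suc m. (a m - a i) * w i) = (\<Sum>q<m. (a (Suc q) - a q) * (\<Sum>i<Suc q. w i))"
proof (induction m)
  case (Suc m)
  have "(\<Sum>i<Suc (Suc m). (a (Suc m) - a i) * w i)
      = (\<Sum>i<Suc m. (a m - a i) * w i) + (a (Suc m) - a m) * (\<Sum>i<Suc m. w i)"
    by (simp add: sum_distrib_left sum.distrib[symmetric] algebra_simps)
  then show ?case using Suc by simp
qed simp

section \<open>Spectral decompositions\<close>

text \<open>
  An \<open>n \<times> n\<close> matrix is a function on index pairs whose values outside \<open>{..<n}\<close> are irrelevant, so
  that a matrix and its leading blocks are given by the same function.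
\<close>

type_synonym cmat = "nat \<Rightarrow> nat \<Rightarrow> complex"

text \<open>Orthonormality of the rows is included because it is the completeness relation behind
  \<open>unitary_expand\<close>; \<open>unitary_funI\<close> derives it from the columns.\<close>

definition unitary_fun :: "nat \<Rightarrow> cmat \<Rightarrow> bool" where
  "unitary_fun n U \<longleftrightarrow>
    (\<forall>j<n. \<forall>k<n. (\<Sum>i<n. cnj (U i j) * U i k) = (if j = k then 1 else 0)) \<and>
    (\<forall>i<n. \<forall>j<n. (\<Sum>k<n. U i k * cnj (U j k)) = (if i = j then 1 else 0))"

definition eigen_decomp :: "nat \<Rightarrow> cmat \<Rightarrow> (nat \<Rightarrow> real) \<Rightarrow> cmat \<Rightarrow> bool" where
  "eigen_decomp n U x M \<longleftrightarrow> unitary_fun n U \<and>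
    (\<forall>i<n. \<forall>k<n. (\<Sum>j<n. M i j * U j k) = of_real (x k) * U i k)"

definition herm :: "nat \<Rightarrow> cmat \<Rightarrow> bool" where
  "herm n M \<longleftrightarrow> (\<forall>i<n. \<forall>j<n. M j i = cnj (M i j))"

definition qform :: "nat \<Rightarrow> cmat \<Rightarrow> (nat \<Rightarrow> complex) \<Rightarrow> real" where
  "qform n M v = Re (\<Sum>i<n. \<Sum>j<n. cnj (v i) * M i j * v j)"

text \<open>The coordinates of \<open>v\<close> in the basis formed by the columns of
  \<open>U\<close>.\<close>

definition coord :: "nat \<Rightarrow> cmat \<Rightarrow> (nat \<Rightarrow> complex) \<Rightarrow> nat \<Rightarrow> complex" where
  "coord n U v k = (\<Sum>i<n. cnj (U i k) * v i)"

text \<open>The \<open>i\<close>-th diagonal entry of \<open>f(M)\<close>, where \<open>M\<close> has eigenvectors \<open>U\<close> and eigenvalues \<open>x\<close>.\<close>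

definition fdiag :: "nat \<Rightarrow> cmat \<Rightarrow> (nat \<Rightarrow> real) \<Rightarrow> (real \<Rightarrow> real) \<Rightarrow> nat \<Rightarrow> real" where
  "fdiag n U x f i = (\<Sum>k<n. (cmod (U i k))\<^sup>2 * f (x k))"

definition diag_plus :: "(nat \<Rightarrow> real) \<Rightarrow> cmat \<Rightarrow> cmat" where
  "diag_plus a B i j = (if i = j then of_real (a i) else 0) + B i j"

section \<open>Orthonormal bases and eigenvector expansions\<close>

lemma sum_delta_mult:
  fixes f :: "nat \<Rightarrow> 'a::semiring_1"
  assumes "j < n"
  shows "(\<Sum>i<n. (if i = j then 1 else 0) * f i) = f j"
    and "(\<Sum>i<n. (if j = i then 1 else 0) * f i) = f j"
    and "(\<Sum>i<n. f i * (if i = j then 1 else 0)) = f j"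
    and "(\<Sum>i<n. f i * (if j = i then 1 else 0)) = f j"
  using assms by (simp_all add: if_distrib[of "\<lambda>x. x * _"] if_distrib[of "\<lambda>x. _ * x"] cong: if_cong)

lemma unitary_cols:
  assumes "unitary_fun n U" "j < n" "k < n"
  shows "(\<Sum>i<n. cnj (U i j) * U i k) = (if j = k then 1 else 0)"
  using assms by (simp add: unitary_fun_def)

lemma unitary_rows:
  assumes "unitary_fun n U" "i < n" "j < n"
  shows "(\<Sum>k<n. U i k * cnj (U j k)) = (if i = j then 1 else 0)"
  using assms by (simp add: unitary_fun_def)

text \<open>The columns give a left inverse, and a left inverse of a square matrix is a right
  inverse.\<close>

lemma unitary_funI:
  assumes cols: "\<And>j k. j < n \<Longrightarrow> k < n \<Longrightarrow> (\<Sum>i<n. cnj (U i j) * U i k) = (if j = k then 1 else 0)"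
  shows "unitary_fun n U"
proof -
  define Um where "Um = mat n n (\<lambda>(i, j). U i j)"
  define Us where "Us = mat n n (\<lambda>(i, j). cnj (U j i))"
  have c: "Um \<in> carrier_mat n n" "Us \<in> carrier_mat n n" by (auto simp: Um_def Us_def)
  have "Us * Um = 1\<^sub>m n"
    by (rule eq_matI) (auto simp: Um_def Us_def scalar_prod_def cols lessThan_atLeast0[symmetric])
  then have r: "Um * Us = 1\<^sub>m n" by (rule mat_mult_left_right_inverse[OF c(2,1)])
  have "(\<Sum>k<n. U i k * cnj (U j k)) = (if i = j then 1 else 0)" if "i < n" "j < n" for i j
  proof -
    have "(Um * Us) $$ (i, j) = (\<Sum>k<n. U i k * cnj (U j k))"
      using that by (simp add: Um_def Us_def scalar_prod_def lessThan_atLeast0[symmetric])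
    then show ?thesis using r that by simp
  qed
  with cols show ?thesis by (simp add: unitary_fun_def)
qed

lemma unitary_inner:
  assumes U: "unitary_fun n U"
  shows "(\<Sum>i<n. cnj (\<Sum>p<n. U i p * u p) * (\<Sum>q<n. U i q * v q)) = (\<Sum>p<n. cnj (u p) * v p)"
proof -
  have "(\<Sum>i<n. cnj (\<Sum>p<n. U i p * u p) * (\<Sum>q<n. U i q * v q))
      = (\<Sum>i<n. \<Sum>p<n. \<Sum>q<n. cnj (u p) * ((cnj (U i p) * U i q) * v q))"
    unfolding cnj_sum sum_product by (intro sum.cong refl) (simp add: mult_ac)
  also have "\<dots> = (\<Sum>p<n. \<Sum>i<n. \<Sum>q<n. cnj (u p) * ((cnj (U i p) * U i q) * v q))"
    by (rule sum.swap)
  also have "\<dots> = (\<Sum>p<n. \<Sum>q<n. \<Sum>i<n. cnj (u p) * ((cnj (U i p) * U i q) * v q))"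
    by (rule sum.cong[OF refl], rule sum.swap)
  also have "\<dots> = (\<Sum>p<n. cnj (u p) * (\<Sum>q<n. (\<Sum>i<n. cnj (U i p) * U i q) * v q))"
    by (simp add: sum_distrib_left sum_distrib_right)
  also have "\<dots> = (\<Sum>p<n. cnj (u p) * v p)"
    using U by (intro sum.cong refl) (simp add: unitary_cols sum_delta_mult)
  finally show ?thesis .
qed

lemma unitary_expand:
  assumes U: "unitary_fun n U" and i: "i < n"
  shows "v i = (\<Sum>k<n. U i k * coord n U v k)"
proof -
  have "(\<Sum>k<n. U i k * coord n U v k) = (\<Sum>k<n. \<Sum>j<n. (U i k * cnj (U j k)) * v j)"
    by (simp add: coord_def sum_distrib_left mult_ac)
  also have "\<dots> = (\<Sum>j<n. \<Sum>k<n. (U i k * cnj (U j k)) * v j)" by (rule sum.swap)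
  also have "\<dots> = (\<Sum>j<n. (\<Sum>k<n. U i k * cnj (U j k)) * v j)" by (simp add: sum_distrib_right)
  also have "\<dots> = (\<Sum>j<n. (if i = j then 1 else 0) * v j)"
    using U i by (intro sum.cong refl) (simp add: unitary_rows)
  finally show ?thesis using i by (simp add: sum_delta_mult)
qed

lemma unitary_parseval:
  assumes U: "unitary_fun n U"
  shows "(\<Sum>k<n. (cmod (coord n U v k))\<^sup>2) = (\<Sum>i<n. (cmod (v i))\<^sup>2)"
proof -
  have "complex_of_real (\<Sum>i<n. (cmod (v i))\<^sup>2) = (\<Sum>i<n. cnj (v i) * v i)"
    by (simp only: of_real_sum complex_norm_square mult.commute)
  also have "\<dots> = (\<Sum>i<n. cnj (\<Sum>k<n. U i k * coord n U v k) * (\<Sum>k<n. U i k * coord n U v k))"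
    using unitary_expand[OF U, of _ v, symmetric] by simp
  also have "\<dots> = (\<Sum>k<n. cnj (coord n U v k) * coord n U v k)" by (rule unitary_inner[OF U])
  also have "\<dots> = complex_of_real (\<Sum>k<n. (cmod (coord n U v k))\<^sup>2)"
    by (simp only: of_real_sum complex_norm_square mult.commute)
  finally show ?thesis by (simp only: of_real_eq_iff)
qed

lemma coord_column:
  assumes "unitary_fun n U" "j < n" "k < n"
  shows "coord n U (\<lambda>i. U i j) k = (if k = j then 1 else 0)"
  using unitary_cols[OF assms(1,3,2)] by (simp add: coord_def)

lemma column_norm:
  assumes "unitary_fun n U" "k < n"
  shows "(\<Sum>i<n. (cmod (U i k))\<^sup>2) = 1"
proof -
  have "complex_of_real (\<Sum>i<n. (cmod (U i k))\<^sup>2) = (\<Sum>i<n. cnj (U i k) * U i k)"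
    by (simp only: of_real_sum complex_norm_square mult.commute)
  also have "\<dots> = of_real 1" using unitary_cols[OF assms assms(2)] by simp
  finally show ?thesis by (simp only: of_real_eq_iff)
qed

lemma unitary_transpose:
  assumes "unitary_fun n U"
  shows "unitary_fun n (\<lambda>i j. U j i)"
proof -
  have *: "(\<Sum>k<n. cnj (U j k) * U i k) = (if j = i then 1 else 0)" if "i < n" "j < n" for i j
    using unitary_rows[OF assms that] by (simp add: mult.commute eq_commute[of j i])
  show ?thesis by (rule unitary_funI) (simp add: *)
qed

lemma unitary_cnj:
  assumes "unitary_fun n U"
  shows "unitary_fun n (\<lambda>i j. cnj (U i j))"
proof (rule unitary_funI)
  fix j k assume "j < n" "k < n"
  from unitary_cols[OF assms this(2,1)]
  show "(\<Sum>i<n. cnj (cnj (U i j)) * cnj (U i k)) = (if j = k then 1 else 0)"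
    by (simp add: mult.commute eq_commute[of j k])
qed

lemma eigen_decompD:
  assumes "eigen_decomp n U x M"
  shows "unitary_fun n U"
    and "\<And>i k. i < n \<Longrightarrow> k < n \<Longrightarrow> (\<Sum>j<n. M i j * U j k) = of_real (x k) * U i k"
  using assms by (auto simp: eigen_decomp_def)

lemma eigen_decomp_apply:
  assumes E: "eigen_decomp n U x M" and i: "i < n"
  shows "(\<Sum>j<n. M i j * v j) = (\<Sum>k<n. of_real (x k) * U i k * coord n U v k)"
proof -
  have "(\<Sum>j<n. M i j * v j) = (\<Sum>j<n. M i j * (\<Sum>k<n. U j k * coord n U v k))"
    using unitary_expand[OF eigen_decompD(1)[OF E], of _ v] by (intro sum.cong) auto
  also have "\<dots> = (\<Sum>j<n. \<Sum>k<n. M i j * U j k * coord n U v k)"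
    by (simp add: sum_distrib_left mult.assoc)
  also have "\<dots> = (\<Sum>k<n. \<Sum>j<n. M i j * U j k * coord n U v k)" by (rule sum.swap)
  also have "\<dots> = (\<Sum>k<n. (\<Sum>j<n. M i j * U j k) * coord n U v k)" by (simp add: sum_distrib_right)
  also have "\<dots> = (\<Sum>k<n. of_real (x k) * U i k * coord n U v k)"
    using eigen_decompD(2)[OF E] i by (intro sum.cong) auto
  finally show ?thesis .
qed

lemma eigen_decomp_entry:
  assumes E: "eigen_decomp n U x M" and i: "i < n" "j < n"
  shows "M i j = (\<Sum>k<n. of_real (x k) * (U i k * cnj (U j k)))"
proof -
  have "M i j = (\<Sum>m<n. M i m * (if m = j then 1 else 0))" using i by (simp add: sum_delta_mult)
  also have "\<dots> = (\<Sum>k<n. of_real (x k) * U i k * coord n U (\<lambda>m. if m = j then 1 else 0) k)"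
    by (rule eigen_decomp_apply[OF E i(1)])
  also have "\<dots> = (\<Sum>k<n. of_real (x k) * (U i k * cnj (U j k)))"
    using i by (simp add: coord_def sum_delta_mult mult.assoc)
  finally show ?thesis .
qed

lemma hermI: "(\<And>i j. i < n \<Longrightarrow> j < n \<Longrightarrow> cnj (M i j) = M j i) \<Longrightarrow> herm n M"
  unfolding herm_def by metis

lemma hermD: "herm n M \<Longrightarrow> i < n \<Longrightarrow> j < n \<Longrightarrow> cnj (M i j) = M j i"
  unfolding herm_def by metis

lemma eigen_decomp_herm: "eigen_decomp n U x M \<Longrightarrow> herm n M"
  unfolding herm_def by (auto simp: eigen_decomp_entry mult_ac)

lemma eigen_decomp_cong:
  assumes "eigen_decomp n U x M" "\<And>i j. i < n \<Longrightarrow> j < n \<Longrightarrow> M i j = N i j"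
  shows "eigen_decomp n U x N"
  using assms unfolding eigen_decomp_def by (auto intro!: sum.cong)

lemma qform_eigen_decomp:
  assumes E: "eigen_decomp n U x M"
  shows "qform n M v = (\<Sum>k<n. x k * (cmod (coord n U v k))\<^sup>2)"
proof -
  have "(\<Sum>i<n. \<Sum>j<n. cnj (v i) * M i j * v j)
      = (\<Sum>i<n. \<Sum>k<n. of_real (x k) * (coord n U v k * (cnj (v i) * U i k)))"
  proof (rule sum.cong[OF refl])
    fix i assume "i \<in> {..<n}"
    have "(\<Sum>j<n. cnj (v i) * M i j * v j) = cnj (v i) * (\<Sum>j<n. M i j * v j)"
      by (simp add: sum_distrib_left mult.assoc)
    also have "\<dots> = cnj (v i) * (\<Sum>k<n. of_real (x k) * U i k * coord n U v k)"
      using eigen_decomp_apply[OF E] \<open>i \<in> {..<n}\<close> by simp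
    finally show "(\<Sum>j<n. cnj (v i) * M i j * v j)
        = (\<Sum>k<n. of_real (x k) * (coord n U v k * (cnj (v i) * U i k)))"
      by (simp add: sum_distrib_left mult_ac)
  qed
  also have "\<dots> = (\<Sum>k<n. of_real (x k) * (coord n U v k * cnj (coord n U v k)))"
    by (subst sum.swap) (simp add: sum_distrib_left coord_def mult_ac)
  also have "\<dots> = of_real (\<Sum>k<n. x k * (cmod (coord n U v k))\<^sup>2)"
    by (simp only: of_real_sum of_real_mult complex_norm_square)
  finally show ?thesis by (simp only: qform_def Re_complex_of_real)
qed

lemma qform_column:
  assumes E: "eigen_decomp n U x M" and k: "k < n"
  shows "qform n M (\<lambda>i. U i k) = x k"
proof -
  have "qform n M (\<lambda>i. U i k) = (\<Sum>l<n. x l * (if l = k then 1 else 0))"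
    unfolding qform_eigen_decomp[OF E] using coord_column[OF eigen_decompD(1)[OF E] k]
    by (intro sum.cong) auto
  then show ?thesis using k by (simp add: sum_delta_mult)
qed

lemma qform_diag_plus: "qform n (diag_plus a B) v = (\<Sum>i<n. a i * (cmod (v i))\<^sup>2) + qform n B v"
proof -
  have "(\<Sum>j<n. cnj (v i) * diag_plus a B i j * v j)
      = of_real (a i * (cmod (v i))\<^sup>2) + (\<Sum>j<n. cnj (v i) * B i j * v j)" if "i < n" for i
  proof -
    have "(\<Sum>j<n. cnj (v i) * diag_plus a B i j * v j)
        = (\<Sum>j<n. (if i = j then 1 else 0) * (cnj (v i) * of_real (a i) * v j) + cnj (v i) * B i j * v j)"
      by (intro sum.cong refl) (auto simp: diag_plus_def algebra_simps)
    also have "\<dots> = cnj (v i) * of_real (a i) * v i + (\<Sum>j<n. cnj (v i) * B i j * v j)"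
      using that by (simp only: sum.distrib sum_delta_mult)
    also have "cnj (v i) * of_real (a i) * v i = of_real (a i * (cmod (v i))\<^sup>2)"
      by (simp only: of_real_mult complex_norm_square mult_ac)
    finally show ?thesis .
  qed
  then have "(\<Sum>i<n. \<Sum>j<n. cnj (v i) * diag_plus a B i j * v j)
      = of_real (\<Sum>i<n. a i * (cmod (v i))\<^sup>2) + (\<Sum>i<n. \<Sum>j<n. cnj (v i) * B i j * v j)"
    by (simp add: sum.distrib)
  then show ?thesis by (simp add: qform_def)
qed

lemma qform_uminus: "qform n (- B) v = - qform n B v"
  by (simp add: qform_def sum_negf)

lemma eigen_decomp_affine:
  assumes E: "eigen_decomp n U x M"
  shows "eigen_decomp n U (\<lambda>k. t + x k) (diag_plus (\<lambda>_. t) M)"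
    and "eigen_decomp n U (\<lambda>k. t - x k) (diag_plus (\<lambda>_. t) (- M))"
proof -
  have d: "(\<Sum>j<n. diag_plus (\<lambda>_. t) N i j * U j k) = of_real t * U i k + (\<Sum>j<n. N i j * U j k)"
    if "i < n" for N i k
  proof -
    have "(\<Sum>j<n. diag_plus (\<lambda>_. t) N i j * U j k)
        = (\<Sum>j<n. (if i = j then 1 else 0) * (of_real t * U j k) + N i j * U j k)"
      by (intro sum.cong refl) (auto simp: diag_plus_def algebra_simps)
    then show ?thesis using that by (simp only: sum.distrib sum_delta_mult)
  qed
  show "eigen_decomp n U (\<lambda>k. t + x k) (diag_plus (\<lambda>_. t) M)"
    "eigen_decomp n U (\<lambda>k. t - x k) (diag_plus (\<lambda>_. t) (- M))"
    using E by (auto simp: eigen_decomp_def d sum_negf distrib_right left_diff_distrib)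
qed

lemma eigen_decomp_diag:
  "eigen_decomp n (\<lambda>i j. if i = j then 1 else 0) a (diag_plus a (\<lambda>_ _. 0))"
proof -
  have *: "cnj (if p then 1 else 0) = (if p then 1 else 0)" for p by simp
  have "unitary_fun n (\<lambda>i j. if i = j then 1 else 0)"
    by (rule unitary_funI) (simp only: * sum_delta_mult)
  moreover have "(\<Sum>j<n. diag_plus a (\<lambda>_ _. 0) i j * (if j = k then 1 else 0))
      = of_real (a k) * (if i = k then 1 else 0)" if "k < n" for i k
    using that by (simp only: sum_delta_mult) (auto simp: diag_plus_def)
  ultimately show ?thesis unfolding eigen_decomp_def by blast
qed

section \<open>Dimension counting and the variational comparison of eigenvalues\<close>

lemma homogeneous_solution:
  fixes G :: cmat
  shows "\<exists>c. (\<exists>t\<le>m. c t \<noteq> 0) \<and> (\<forall>l<m. (\<Sum>t\<le>m. G l t * c t) = 0)"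
proof -
  \<comment> \<open>The system is padded to a square matrix by a zero row; the last unit vector then
    lies in the kernel of the transpose, so the determinant vanishes.\<close>
  define A where "A = mat (Suc m) (Suc m) (\<lambda>(l, t). if l < m then G l t else 0)"
  have A: "A \<in> carrier_mat (Suc m) (Suc m)" by (simp add: A_def)
  have "transpose_mat A *\<^sub>v unit_vec (Suc m) m = 0\<^sub>v (Suc m)"
    by (rule eq_vecI) (auto simp: A_def scalar_prod_def)
  moreover have "(unit_vec (Suc m) m :: complex vec) \<noteq> 0\<^sub>v (Suc m)"
    by (auto simp: vec_eq_iff)
  ultimately have "det (transpose_mat A) = 0"
    using A by (subst det_0_iff_vec_prod_zero[of _ "Suc m"]) (auto intro!: exI[of _ "unit_vec (Suc m) m"])
  then have "det A = 0" using det_transpose[OF A] by simp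
  then obtain v where v: "v \<in> carrier_vec (Suc m)" "v \<noteq> 0\<^sub>v (Suc m)" "A *\<^sub>v v = 0\<^sub>v (Suc m)"
    using det_0_iff_vec_prod_zero[OF A] by auto
  have "\<exists>t\<le>m. v $ t \<noteq> 0"
  proof (rule ccontr)
    assume "\<not> ?thesis"
    then have "v = 0\<^sub>v (Suc m)" using v(1) by (intro eq_vecI) auto
    with v(2) show False ..
  qed
  moreover have "(\<Sum>t\<le>m. G l t * v $ t) = 0" if "l < m" for l
  proof -
    have "(A *\<^sub>v v) $ l = (\<Sum>t\<le>m. G l t * v $ t)"
      using that v(1) A by (simp add: A_def scalar_prod_def lessThan_atLeast0[symmetric] lessThan_Suc_atMost)
    with v(3) that show ?thesis by simp
  qed
  ultimately show ?thesis by (intro exI[of _ "\<lambda>t. v $ t"]) auto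
qed

text \<open>Contains both the Cauchy interlacing inequality (\<open>M = N\<close>) and Weyl's monotonicity principle (\<open>r = n\<close>).\<close>

lemma eigenvalue_comparison:
  assumes E: "eigen_decomp n W b N" and F: "eigen_decomp r V \<beta> M" and r: "r \<le> n"
    and b: "\<And>i j. i \<le> j \<Longrightarrow> j < n \<Longrightarrow> b i \<le> b j"
    and \<beta>: "\<And>i j. i \<le> j \<Longrightarrow> j < r \<Longrightarrow> \<beta> i \<le> \<beta> j"
    and le: "\<And>v. (\<forall>i\<ge>r. v i = 0) \<Longrightarrow> qform n N v \<le> qform r M v"
    and j: "j < r"
  shows "b j \<le> \<beta> j"
proof -
  define e where "e = (\<lambda>t i. if i < r then V i t else 0)"
  \<comment> \<open>Courant-Fischer: \<open>j + 1\<close> columns of \<open>V\<close>, extended by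
    zero, against \<open>j\<close> orthogonality conditions to the lowest eigenvectors of
    \<open>N\<close>. The resulting \<open>v\<close> has Rayleigh quotient at least
    \<open>b j\<close> for \<open>N\<close> and at most \<open>\<beta> j\<close> for
    \<open>M\<close>.\<close>
  obtain c where c: "\<exists>t\<le>j. c t \<noteq> 0" "\<And>l. l < j \<Longrightarrow> (\<Sum>t\<le>j. coord n W (e t) l * c t) = 0"
    using homogeneous_solution[of j "\<lambda>l t. coord n W (e t) l"] by auto
  define c' where "c' = (\<lambda>t. if t \<le> j then c t else 0)"
  define v where "v = (\<lambda>i. \<Sum>t\<le>j. e t i * c t)"
  have v0: "\<forall>i\<ge>r. v i = 0" by (auto simp: v_def e_def)
  have UV: "unitary_fun r V" and UW: "unitary_fun n W" using E F by (auto dest: eigen_decompD)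
  have vW: "coord n W v l = 0" if "l < j" for l
  proof -
    have "coord n W v l = (\<Sum>i<n. \<Sum>t\<le>j. cnj (W i l) * e t i * c t)"
      by (simp add: coord_def v_def sum_distrib_left mult.assoc)
    also have "\<dots> = (\<Sum>t\<le>j. \<Sum>i<n. cnj (W i l) * e t i * c t)" by (rule sum.swap)
    also have "\<dots> = (\<Sum>t\<le>j. coord n W (e t) l * c t)"
      by (simp add: coord_def sum_distrib_right)
    finally show ?thesis using c(2)[OF that] by simp
  qed
  have vV: "coord r V v k = c' k" if "k < r" for k
  proof -
    have "coord r V v k = (\<Sum>i<r. \<Sum>t\<le>j. cnj (V i k) * V i t * c t)"
      unfolding coord_def v_def by (intro sum.cong refl) (simp add: e_def sum_distrib_left mult.assoc)
    also have "\<dots> = (\<Sum>t\<le>j. \<Sum>i<r. cnj (V i k) * V i t * c t)" by (rule sum.swap)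
    also have "\<dots> = (\<Sum>t\<le>j. (if k = t then 1 else 0) * c t)"
      using that j by (intro sum.cong refl) (simp add: sum_distrib_right[symmetric] unitary_cols[OF UV])
    also have "\<dots> = c' k"
      by (simp add: c'_def if_distrib[of "\<lambda>x. x * _"] cong: if_cong)
    finally show ?thesis .
  qed
  define S where "S = (\<Sum>i<n. (cmod (v i))\<^sup>2)"
  have "S = (\<Sum>i<r. (cmod (v i))\<^sup>2)"
    unfolding S_def by (rule sum.mono_neutral_right) (use r v0 in auto)
  also have "\<dots> = (\<Sum>k<r. (cmod (c' k))\<^sup>2)"
    unfolding unitary_parseval[OF UV, of v, symmetric] using vV by simp
  finally have S: "S = (\<Sum>k<r. (cmod (c' k))\<^sup>2)" .
  have "0 < S"
  proof -
    obtain t where "t \<le> j" "c t \<noteq> 0" using c(1) by auto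
    then have "0 < (cmod (c' t))\<^sup>2" "t < r" using j by (auto simp: c'_def)
    then show ?thesis unfolding S by (intro sum_pos2[of _ t]) auto
  qed
  have "b j * S = (\<Sum>k<n. b j * (cmod (coord n W v k))\<^sup>2)"
    unfolding S_def unitary_parseval[OF UW, of v, symmetric] by (simp add: sum_distrib_left)
  also have "\<dots> \<le> (\<Sum>k<n. b k * (cmod (coord n W v k))\<^sup>2)"
  proof (rule sum_mono)
    fix k assume "k \<in> {..<n}"
    then show "b j * (cmod (coord n W v k))\<^sup>2 \<le> b k * (cmod (coord n W v k))\<^sup>2"
      using vW b by (cases "k < j") (auto intro!: mult_right_mono)
  qed
  also have "\<dots> \<le> qform r M v" using le[OF v0] qform_eigen_decomp[OF E] by simp
  also have "\<dots> = (\<Sum>k<r. \<beta> k * (cmod (c' k))\<^sup>2)"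
    unfolding qform_eigen_decomp[OF F] using vV by simp
  also have "\<dots> \<le> (\<Sum>k<r. \<beta> j * (cmod (c' k))\<^sup>2)"
  proof (rule sum_mono)
    fix k assume "k \<in> {..<r}"
    then show "\<beta> k * (cmod (c' k))\<^sup>2 \<le> \<beta> j * (cmod (c' k))\<^sup>2"
      using \<beta> j by (cases "k \<le> j") (auto simp: c'_def intro!: mult_right_mono)
  qed
  also have "\<dots> = \<beta> j * S" by (simp add: S sum_distrib_left)
  finally show ?thesis using \<open>0 < S\<close> by simp
qed

section \<open>The spectral theorem\<close>

lemma unitary_extension:
  assumes v: "(\<Sum>i<n. (cmod (v i))\<^sup>2) = 1"
  shows "\<exists>W. unitary_fun n W \<and> (\<forall>i. W i 0 = v i)"
proof -
  have norm: "(\<Sum>i<n. cnj (w i) * w i) = complex_of_real (\<Sum>i<n. (cmod (w i))\<^sup>2)" for w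
    by (simp only: of_real_sum complex_norm_square mult.commute)
  have n: "0 < n" using v by (cases n) auto
  have "\<exists>W. (\<forall>i. W i 0 = v i) \<and>
      (\<forall>p<Suc k. \<forall>q<Suc k. (\<Sum>i<n. cnj (W i p) * W i q) = (if p = q then 1 else 0))" if "k < n" for k
    using that
  proof (induction k)
    case 0
    then show ?case using v by (intro exI[of _ "\<lambda>i _. v i"]) (simp add: norm)
  next
    case (Suc k)
    then obtain W where W: "\<And>i. W i 0 = v i"
      "\<And>p q. p < Suc k \<Longrightarrow> q < Suc k \<Longrightarrow> (\<Sum>i<n. cnj (W i p) * W i q) = (if p = q then 1 else 0)"
      by auto
    \<comment> \<open>In place of Gram-Schmidt: \<open>n\<close> unknowns and \<open>n - 1\<close>
      equations. Those with \<open>l \<le> k\<close> are among them because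
      \<open>Suc k < n\<close>; the others only pad the system to this size.\<close>
    obtain c where c: "\<exists>t\<le>n - 1. c t \<noteq> 0"
      "\<And>l. l < n - 1 \<Longrightarrow> (\<Sum>t\<le>n - 1. cnj (W t l) * c t) = 0"
      using homogeneous_solution[of "n - 1" "\<lambda>l t. cnj (W t l)"] by auto
    have n1: "{..n - 1} = {..<n}" using n by auto
    define s where "s = (\<Sum>i<n. (cmod (c i))\<^sup>2)"
    obtain t where "t \<le> n - 1" "c t \<noteq> 0" using c(1) by auto
    then have "t < n" "c t \<noteq> 0" using n by auto
    then have "0 < s" unfolding s_def by (intro sum_pos2[of _ t]) auto
    define w where "w = (\<lambda>i. c i / of_real (sqrt s))"
    have w0: "(\<Sum>i<n. cnj (W i p) * w i) = 0" if "p < Suc k" for p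
      using c(2)[of p, unfolded n1] that Suc.prems by (simp add: w_def sum_divide_distrib[symmetric])
    have w0': "(\<Sum>i<n. cnj (w i) * W i p) = 0" if "p < Suc k" for p
      using arg_cong[OF w0[OF that], of cnj] by (simp add: mult.commute)
    have "(\<Sum>i<n. (cmod (w i))\<^sup>2) = (\<Sum>i<n. (cmod (c i))\<^sup>2 / s)"
      using \<open>0 < s\<close> by (simp add: w_def norm_divide power_divide)
    then have w1: "(\<Sum>i<n. cnj (w i) * w i) = 1"
      using \<open>0 < s\<close> by (simp add: norm sum_divide_distrib[symmetric] s_def)
    show ?case
      using W w0 w0' w1
      by (intro exI[of _ "\<lambda>i p. if p = Suc k then w i else W i p"]) (auto simp: less_Suc_eq)
  qed
  from this[of "n - 1"] n obtain W where "\<And>i. W i 0 = v i"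
    "\<And>p q. p < n \<Longrightarrow> q < n \<Longrightarrow> (\<Sum>i<n. cnj (W i p) * W i q) = (if p = q then 1 else 0)"
    by auto
  then show ?thesis by (intro exI[of _ W] conjI unitary_funI) auto
qed

text \<open>\<open>N\<close> is \<open>M\<close> written in the basis \<open>W\<close>, and its
  eigenvectors are carried back by \<open>W\<close>. The eigenvalue equation is checked on
  coordinates in \<open>W\<close>, which avoids solving the relation for \<open>M\<close>.\<close>

lemma eigen_decomp_conjugate:
  assumes W: "unitary_fun n W" and E: "eigen_decomp n U x N"
    and N: "\<And>i j. i < n \<Longrightarrow> j < n \<Longrightarrow> N i j = (\<Sum>k<n. cnj (W k i) * (\<Sum>l<n. M k l * W l j))"
  shows "eigen_decomp n (\<lambda>i k. \<Sum>j<n. W i j * U j k) x M"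
  unfolding eigen_decomp_def
proof (intro conjI allI impI)
  note U = eigen_decompD[OF E]
  show "unitary_fun n (\<lambda>i k. \<Sum>j<n. W i j * U j k)"
    by (rule unitary_funI) (simp only: unitary_inner[OF W] unitary_cols[OF U(1)])
  fix i k assume i: "i < n" and k: "k < n"
  define u where "u = (\<lambda>i. \<Sum>j<n. M i j * (\<Sum>m<n. W j m * U m k))"
  have "coord n W u p = of_real (x k) * U p k" if "p < n" for p
  proof -
    define MW where "MW = (\<lambda>i m. \<Sum>l<n. M i l * W l m)"
    have u: "u i = (\<Sum>m<n. MW i m * U m k)" for i
      unfolding u_def MW_def sum_distrib_left sum_distrib_right
      by (subst sum.swap) (simp add: mult.assoc)
    have "coord n W u p = (\<Sum>m<n. (\<Sum>i<n. cnj (W i p) * MW i m) * U m k)"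
      unfolding coord_def u sum_distrib_left sum_distrib_right
      by (subst sum.swap) (simp add: mult.assoc)
    also have "\<dots> = (\<Sum>m<n. N p m * U m k)" using N that by (simp add: MW_def)
    finally show ?thesis using U(2)[OF that k] by simp
  qed
  then have "u i = (\<Sum>p<n. W i p * (of_real (x k) * U p k))"
    using unitary_expand[OF W i, of u] by simp
  then show "(\<Sum>j<n. M i j * (\<Sum>j'<n. W j j' * U j' k)) = of_real (x k) * (\<Sum>j<n. W i j * U j k)"
    by (simp add: u_def sum_distrib_left mult_ac)
qed

lemma eigenvector_exists:
  fixes M :: cmat
  assumes n: "0 < n"
  shows "\<exists>\<mu> v. (\<Sum>i<n. (cmod (v i))\<^sup>2) = 1 \<and> (\<forall>i<n. (\<Sum>j<n. M i j * v j) = \<mu> * v i)"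
proof -
  define A where "A = mat n n (\<lambda>(i, j). M i j)"
  have A: "A \<in> carrier_mat n n" by (simp add: A_def)
  obtain \<mu> v where v: "v \<in> carrier_vec n" "v \<noteq> 0\<^sub>v n" "A *\<^sub>v v = \<mu> \<cdot>\<^sub>v v"
    using spectrum_non_empty[OF A n] A by (auto simp: spectrum_def eigenvalue_def eigenvector_def)
  have ev: "(\<Sum>j<n. M i j * v $ j) = \<mu> * v $ i" if "i < n" for i
  proof -
    have "(A *\<^sub>v v) $ i = (\<Sum>j<n. M i j * v $ j)"
      using that v(1) by (simp add: A_def scalar_prod_def lessThan_atLeast0[symmetric])
    then show ?thesis using v that by simp
  qed
  define s where "s = (\<Sum>i<n. (cmod (v $ i))\<^sup>2)"
  have "\<exists>t<n. v $ t \<noteq> 0"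
  proof (rule ccontr)
    assume "\<not> ?thesis"
    then have "v = 0\<^sub>v n" using v(1) by (intro eq_vecI) auto
    with v(2) show False ..
  qed
  then obtain t where "t < n" "v $ t \<noteq> 0" by auto
  then have s: "0 < s" unfolding s_def by (intro sum_pos2[of _ t]) auto
  have "(\<Sum>i<n. (cmod (v $ i / of_real (sqrt s)))\<^sup>2) = 1"
    using s by (simp add: norm_divide power_divide sum_divide_distrib[symmetric] s_def[symmetric])
  then show ?thesis
    using ev by (intro exI[of _ \<mu>] exI[of _ "\<lambda>i. v $ i / of_real (sqrt s)"])
      (auto simp: sum_divide_distrib[symmetric])
qed

lemma spectral_theorem:
  assumes "herm n M"
  shows "\<exists>U x. eigen_decomp n U x M"
  using assms
proof (induction n arbitrary: M)
  case 0
  then show ?case by (auto simp: eigen_decomp_def unitary_fun_def)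
next
  case (Suc m)
  let ?n = "Suc m"
  obtain \<mu> v where v: "(\<Sum>i<?n. (cmod (v i))\<^sup>2) = 1"
    "\<And>i. i < ?n \<Longrightarrow> (\<Sum>j<?n. M i j * v j) = \<mu> * v i"
    using eigenvector_exists[of ?n M] by auto
  obtain W where W: "unitary_fun ?n W" "\<And>i. W i 0 = v i"
    using unitary_extension[OF v(1)] by auto
  define N where "N = (\<lambda>i j. \<Sum>k<?n. cnj (W k i) * (\<Sum>l<?n. M k l * W l j))"
  have hN: "N j i = cnj (N i j)" for i j
  proof -
    have "cnj (N i j) = (\<Sum>k<?n. \<Sum>l<?n. W k i * cnj (M k l) * cnj (W l j))"
      unfolding N_def by (simp add: sum_distrib_left mult.assoc del: sum.lessThan_Suc)
    also have "\<dots> = (\<Sum>k<?n. \<Sum>l<?n. W k i * M l k * cnj (W l j))"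
      by (intro sum.cong refl) (simp add: hermD[OF Suc.prems])
    also have "\<dots> = (\<Sum>l<?n. \<Sum>k<?n. W k i * M l k * cnj (W l j))" by (rule sum.swap)
    also have "\<dots> = N j i"
      unfolding N_def by (simp add: sum_distrib_left mult_ac del: sum.lessThan_Suc)
    finally show ?thesis by simp
  qed
  \<comment> \<open>Deflation: the first column of \<open>W\<close> is an eigenvector, so the first
    column of the transformed matrix is \<open>\<mu>\<close> times the first unit vector. By
    hermiticity the first row follows, and the remaining block is again Hermitian.\<close>
  have N0: "N i 0 = (if i = 0 then \<mu> else 0)" if "i < ?n" for i
  proof -
    have "N i 0 = (\<Sum>k<?n. cnj (W k i) * (\<mu> * W k 0))"
      unfolding N_def W(2) using v(2) by (intro sum.cong refl) simp
    also have "\<dots> = \<mu> * (\<Sum>k<?n. cnj (W k i) * W k 0)"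
      unfolding sum_distrib_left by (intro sum.cong refl) (simp add: mult_ac)
    also have "\<dots> = (if i = 0 then \<mu> else 0)"
      by (subst unitary_cols[OF W(1) that]) auto
    finally show ?thesis .
  qed
  have "cnj \<mu> = \<mu>" using hN[of 0 0] N0[of 0] by simp
  then have \<mu>: "\<mu> = of_real (Re \<mu>)" by (simp add: complex_eq_iff)
  have N0': "N 0 j = (if j = 0 then of_real (Re \<mu>) else 0)" if "j < ?n" for j
    using hN[of j 0] N0[OF that] \<open>cnj \<mu> = \<mu>\<close> \<mu> by auto
  have "herm m (\<lambda>i j. N (Suc i) (Suc j))"
    unfolding herm_def by (intro allI impI) (rule hN)
  then obtain U x where U: "eigen_decomp m U x (\<lambda>i j. N (Suc i) (Suc j))"
    using Suc.IH by blast
  define U' where "U' = (\<lambda>i j. case (i, j) of (Suc i, Suc j) \<Rightarrow> U i j | (0, 0) \<Rightarrow> 1 | _ \<Rightarrow> 0)"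
  define x' where "x' = case_nat (Re \<mu>) x"
  have U': "U' 0 0 = 1" "U' 0 (Suc j) = 0" "U' (Suc i) 0 = 0" "U' (Suc i) (Suc j) = U i j" for i j
    by (auto simp: U'_def)
  have "eigen_decomp ?n U' x' N"
    unfolding eigen_decomp_def
  proof (intro conjI allI impI unitary_funI)
    fix j k assume "j < ?n" "k < ?n"
    then show "(\<Sum>i<?n. cnj (U' i j) * U' i k) = (if j = k then 1 else 0)"
      using unitary_cols[OF eigen_decompD(1)[OF U]]
      by (cases j; cases k) (simp_all add: sum.lessThan_Suc_shift U' del: sum.lessThan_Suc)
  next
    fix i k assume "i < ?n" "k < ?n"
    then show "(\<Sum>j<?n. N i j * U' j k) = of_real (x' k) * U' i k"
      using eigen_decompD(2)[OF U] N0 N0' \<mu>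
      by (cases i; cases k) (simp_all add: sum.lessThan_Suc_shift U' x'_def del: sum.lessThan_Suc)
  qed
  then have "eigen_decomp ?n (\<lambda>i k. \<Sum>j<?n. W i j * U' j k) x' M"
    by (rule eigen_decomp_conjugate[OF W(1)]) (simp only: N_def)
  then show ?case by blast
qed

lemma spectral_theorem_sorted:
  assumes "herm n M"
  shows "\<exists>U x. eigen_decomp n U x M \<and> (\<forall>i j. i \<le> j \<longrightarrow> j < n \<longrightarrow> x i \<le> x j)"
proof -
  obtain U x where E: "eigen_decomp n U x M" using spectral_theorem[OF assms] by blast
  define xs where "xs = sort_key x [0..<n]"
  have xs: "length xs = n" "set xs = {..<n}" "distinct xs" "sorted (map x xs)"
    by (auto simp: xs_def)
  have lt: "xs ! k < n" if "k < n" for k using xs that nth_mem by fastforce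
  have "unitary_fun n (\<lambda>i k. U i (xs ! k))"
    using xs lt by (intro unitary_funI) (simp add: unitary_cols[OF eigen_decompD(1)[OF E]] nth_eq_iff_index_eq)
  then have "eigen_decomp n (\<lambda>i k. U i (xs ! k)) (\<lambda>k. x (xs ! k)) M"
    using eigen_decompD(2)[OF E] lt by (simp add: eigen_decomp_def)
  moreover have "x (xs ! i) \<le> x (xs ! j)" if "i \<le> j" "j < n" for i j
    using sorted_nth_mono[OF xs(4), of i j] that xs(1) by simp
  ultimately show ?thesis by blast
qed

section \<open>Locality of the functional calculus on reducing blocks\<close>

text \<open>
  With \<open>P\<close>, \<open>Q\<close> the spectral projections of the two matrices, the numbers \<open>c k l\<close> are
  \<open>\<langle>e\<^sub>i, P\<^sub>k 1\<^sub>I Q\<^sub>l e\<^sub>i\<rangle>\<close>: they have the spectral weights of \<open>e\<^sub>i\<close> as marginals and vanish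
  unless the \<open>k\<close>-th and the \<open>l\<close>-th eigenvalue coincide.
\<close>

lemma fdiag_reducing_block:
  assumes E: "eigen_decomp n U x X" and F: "eigen_decomp m V y Y"
    and I: "I \<subseteq> {..<n}" "I \<subseteq> {..<m}" and i: "i \<in> I"
    and XY: "\<And>j k. j \<in> I \<Longrightarrow> k \<in> I \<Longrightarrow> X j k = Y j k"
    and X0: "\<And>j k. j \<in> I \<Longrightarrow> k < n \<Longrightarrow> k \<notin> I \<Longrightarrow> X j k = 0"
    and Y0: "\<And>j k. j \<in> I \<Longrightarrow> k < m \<Longrightarrow> k \<notin> I \<Longrightarrow> Y j k = 0"
  shows "fdiag n U x f i = fdiag m V y f i"
proof -
  have fin: "finite I" using I finite_subset by blast
  have in_n: "j < n" "j < m" if "j \<in> I" for j using I that by auto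
  note U = eigen_decompD[OF E] note V = eigen_decompD[OF F]
  define d where "d = (\<lambda>k l. \<Sum>j\<in>I. cnj (U j k) * V j l)"
  define c where "c = (\<lambda>k l. U i k * d k l * cnj (V i l))"
  have eqU: "of_real (x k) * U j k = (\<Sum>p\<in>I. X j p * U p k)" if "j \<in> I" "k < n" for j k
    unfolding U(2)[OF in_n(1)[OF that(1)] that(2), symmetric]
    by (rule sum.mono_neutral_right) (use I X0 that in auto)
  have eqV: "of_real (y l) * V j l = (\<Sum>p\<in>I. Y j p * V p l)" if "j \<in> I" "l < m" for j l
    unfolding V(2)[OF in_n(2)[OF that(1)] that(2), symmetric]
    by (rule sum.mono_neutral_right) (use I Y0 that in auto)
  have hX: "cnj (X j p) = X p j" if "j \<in> I" "p \<in> I" for j p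
    using hermD[OF eigen_decomp_herm[OF E]] in_n that by blast
  \<comment> \<open>Restricted to \<open>I\<close>, both eigenvectors solve the eigenvalue equation
    of the common Hermitian block, so they are orthogonal there unless the eigenvalues
    agree.\<close>
  have "of_real (x k) * d k l = of_real (y l) * d k l" if "k < n" "l < m" for k l
  proof -
    have "of_real (x k) * d k l = (\<Sum>j\<in>I. cnj (of_real (x k) * U j k) * V j l)"
      by (simp add: d_def sum_distrib_left mult.assoc)
    also have "\<dots> = (\<Sum>j\<in>I. \<Sum>p\<in>I. cnj (U p k) * (X p j * V j l))"
      using eqU that hX by (intro sum.cong refl) (simp add: sum_distrib_left sum_distrib_right mult_ac)
    also have "\<dots> = (\<Sum>p\<in>I. \<Sum>j\<in>I. cnj (U p k) * (X p j * V j l))" by (rule sum.swap)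
    also have "\<dots> = (\<Sum>p\<in>I. cnj (U p k) * (of_real (y l) * V p l))"
      using eqV that XY by (intro sum.cong refl) (simp add: sum_distrib_left)
    also have "\<dots> = of_real (y l) * d k l" by (simp add: d_def sum_distrib_left mult_ac)
    finally show ?thesis .
  qed
  then have "x k = y l \<or> c k l = 0" if "k < n" "l < m" for k l
    using that by (force simp: c_def)
  then have fxy: "of_real (f (x k)) * c k l = of_real (f (y l)) * c k l" if "k < n" "l < m" for k l
    using that by force
  have c1: "(\<Sum>l<m. c k l) = of_real ((cmod (U i k))\<^sup>2)" for k
  proof -
    have "(\<Sum>l<m. c k l) = (\<Sum>l<m. \<Sum>j\<in>I. U i k * (cnj (U j k) * (V j l * cnj (V i l))))"
      by (simp add: c_def d_def sum_distrib_left sum_distrib_right mult.assoc)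
    also have "\<dots> = (\<Sum>j\<in>I. U i k * (cnj (U j k) * (\<Sum>l<m. V j l * cnj (V i l))))"
      by (subst sum.swap) (simp add: sum_distrib_left)
    also have "\<dots> = (\<Sum>j\<in>I. if j = i then U i k * cnj (U j k) else 0)"
      using in_n i by (intro sum.cong refl) (simp add: unitary_rows[OF V(1)])
    also have "\<dots> = of_real ((cmod (U i k))\<^sup>2)"
      using i fin by (simp only: complex_norm_square sum.delta if_True)
    finally show ?thesis .
  qed
  have c2: "(\<Sum>k<n. c k l) = of_real ((cmod (V i l))\<^sup>2)" for l
  proof -
    have "(\<Sum>k<n. c k l) = (\<Sum>k<n. \<Sum>j\<in>I. V j l * cnj (V i l) * (U i k * cnj (U j k)))"
      by (simp add: c_def d_def sum_distrib_left sum_distrib_right mult_ac)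
    also have "\<dots> = (\<Sum>j\<in>I. V j l * cnj (V i l) * (\<Sum>k<n. U i k * cnj (U j k)))"
      by (subst sum.swap) (simp add: sum_distrib_left)
    also have "\<dots> = (\<Sum>j\<in>I. if j = i then V j l * cnj (V i l) else 0)"
      using in_n i by (intro sum.cong refl) (auto simp: unitary_rows[OF U(1)])
    also have "\<dots> = of_real ((cmod (V i l))\<^sup>2)"
      using i fin by (simp only: complex_norm_square sum.delta if_True)
    finally show ?thesis .
  qed
  have "complex_of_real (fdiag n U x f i) = (\<Sum>k<n. \<Sum>l<m. of_real (f (x k)) * c k l)"
    unfolding fdiag_def of_real_sum of_real_mult c1[symmetric] sum_distrib_left[symmetric]
    by (intro sum.cong refl mult.commute)
  also have "\<dots> = (\<Sum>l<m. \<Sum>k<n. of_real (f (y l)) * c k l)"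
    by (subst sum.swap) (auto intro!: sum.cong simp: fxy)
  also have "\<dots> = complex_of_real (fdiag m V y f i)"
    unfolding fdiag_def of_real_sum of_real_mult c2[symmetric] sum_distrib_left[symmetric]
    by (intro sum.cong refl mult.commute)
  finally show ?thesis by (simp only: of_real_eq_iff)
qed

lemma sum_fdiag:
  assumes "unitary_fun n U"
  shows "(\<Sum>i<n. fdiag n U x f i) = (\<Sum>k<n. f (x k))"
  unfolding fdiag_def
  by (subst sum.swap) (simp add: sum_distrib_right[symmetric] column_norm[OF assms])

lemma trace_fun_unique:
  fixes f :: "real \<Rightarrow> real"
  assumes E: "eigen_decomp n U x X" and F: "eigen_decomp n V y X"
  shows "(\<Sum>k<n. f (x k)) = (\<Sum>k<n. f (y k))"
proof -
  have "(\<Sum>i<n. fdiag n U x f i) = (\<Sum>i<n. fdiag n V y f i)"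
    by (rule sum.cong[OF refl], rule fdiag_reducing_block[OF E F, of "{..<n}"]) auto
  then show ?thesis using sum_fdiag E F by (metis eigen_decompD(1))
qed

section \<open>Trace inequalities\<close>

text \<open>Naming one decomposition makes the trace and the diagonal of \<open>f(M)\<close>
  functions of the matrix alone; \<open>trace_fun_eq\<close> and \<open>fun_diag_eq\<close> then
  allow computing with any other.\<close>

definition spectral_choice :: "nat \<Rightarrow> cmat \<Rightarrow> cmat \<times> (nat \<Rightarrow> real)" where
  "spectral_choice n M = (SOME (U, x). eigen_decomp n U x M)"

definition trace_fun :: "nat \<Rightarrow> (real \<Rightarrow> real) \<Rightarrow> cmat \<Rightarrow> real" where
  "trace_fun n f M = (\<Sum>k<n. f (snd (spectral_choice n M) k))"

definition fun_diag :: "nat \<Rightarrow> (real \<Rightarrow> real) \<Rightarrow> cmat \<Rightarrow> nat \<Rightarrow> real" where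
  "fun_diag n f M = fdiag n (fst (spectral_choice n M)) (snd (spectral_choice n M)) f"

lemma spectral_choice:
  assumes "eigen_decomp n U x M"
  shows "eigen_decomp n (fst (spectral_choice n M)) (snd (spectral_choice n M)) M"
  using someI[of "\<lambda>(U, x). eigen_decomp n U x M" "(U, x)"] assms
  by (simp add: spectral_choice_def case_prod_unfold)

lemma trace_fun_eq:
  assumes "eigen_decomp n U x M"
  shows "trace_fun n f M = (\<Sum>k<n. f (x k))"
  unfolding trace_fun_def by (rule trace_fun_unique[OF spectral_choice[OF assms] assms])

lemma fun_diag_eq:
  assumes "eigen_decomp n U x M" "i < n"
  shows "fun_diag n f M i = fdiag n U x f i"
  unfolding fun_diag_def
  by (rule fdiag_reducing_block[OF spectral_choice[OF assms(1)] assms(1), of "{..<n}"])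
    (use assms(2) in auto)

section \<open>Klein's inequality, and Jensen's inequality for compressions\<close>

lemma coord_swap: "cmod (coord n U (\<lambda>i. V i l) k) = cmod (coord n V (\<lambda>i. U i k) l)"
proof -
  have "coord n U (\<lambda>i. V i l) k = cnj (coord n V (\<lambda>i. U i k) l)"
    by (simp add: coord_def mult.commute)
  then show ?thesis by simp
qed

text \<open>The squared overlaps of the two eigenbases form a doubly stochastic matrix, and the mean
  of \<open>y\<close> under its \<open>k\<close>-th row is the Rayleigh quotient of the perturbed
  matrix at the \<open>k\<close>-th old eigenvector. Averaging the scalar tangent inequality gives a
  first-order bound for traces without differentiation.\<close>

lemma klein_inequality:
  assumes E: "eigen_decomp n U x M" and F: "eigen_decomp n V y (diag_plus \<delta> M)"
    and tangent: "\<And>k l. k < n \<Longrightarrow> l < n \<Longrightarrow> f (x k) + g (x k) * (y l - x k) \<le> f (y l)"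
  shows "(\<Sum>k<n. f (x k)) + (\<Sum>i<n. \<delta> i * fdiag n U x g i) \<le> (\<Sum>l<n. f (y l))"
proof -
  note UE = eigen_decompD(1)[OF E] note UF = eigen_decompD(1)[OF F]
  define p where "p = (\<lambda>k l. (cmod (coord n V (\<lambda>i. U i k) l))\<^sup>2)"
  have p0: "0 \<le> p k l" for k l by (simp add: p_def)
  have p1: "(\<Sum>l<n. p k l) = 1" if "k < n" for k
    unfolding p_def unitary_parseval[OF UF] column_norm[OF UE that] ..
  have p2: "(\<Sum>k<n. p k l) = 1" if "l < n" for l
    unfolding p_def coord_swap[of n V U] unitary_parseval[OF UE] column_norm[OF UF that] ..
  have py: "(\<Sum>l<n. p k l * y l) = x k + (\<Sum>i<n. \<delta> i * (cmod (U i k))\<^sup>2)" if "k < n" for k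
  proof -
    have "(\<Sum>l<n. p k l * y l) = qform n (diag_plus \<delta> M) (\<lambda>i. U i k)"
      by (simp add: qform_eigen_decomp[OF F] p_def mult.commute)
    then show ?thesis using qform_column[OF E that] by (simp add: qform_diag_plus)
  qed
  have "(\<Sum>i<n. \<delta> i * fdiag n U x g i) = (\<Sum>k<n. g (x k) * (\<Sum>i<n. \<delta> i * (cmod (U i k))\<^sup>2))"
    unfolding fdiag_def sum_distrib_left by (subst sum.swap) (simp add: mult_ac)
  then have "(\<Sum>k<n. f (x k)) + (\<Sum>i<n. \<delta> i * fdiag n U x g i)
      = (\<Sum>k<n. f (x k) + g (x k) * (\<Sum>i<n. \<delta> i * (cmod (U i k))\<^sup>2))"
    by (simp add: sum.distrib)
  also have "\<dots> = (\<Sum>k<n. \<Sum>l<n. p k l * (f (x k) + g (x k) * (y l - x k)))"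
  proof (intro sum.cong refl)
    fix k assume "k \<in> {..<n}"
    then have k: "k < n" by simp
    have "(\<Sum>l<n. p k l * (f (x k) + g (x k) * (y l - x k)))
        = (\<Sum>l<n. p k l * (f (x k) - g (x k) * x k) + g (x k) * (p k l * y l))"
      by (intro sum.cong refl) (simp add: algebra_simps)
    also have "\<dots> = (\<Sum>l<n. p k l) * (f (x k) - g (x k) * x k) + g (x k) * (\<Sum>l<n. p k l * y l)"
      by (simp add: sum.distrib sum_distrib_left sum_distrib_right)
    also have "\<dots> = f (x k) + g (x k) * (\<Sum>i<n. \<delta> i * (cmod (U i k))\<^sup>2)"
      unfolding p1[OF k] py[OF k] by (simp add: algebra_simps)
    finally show "f (x k) + g (x k) * (\<Sum>i<n. \<delta> i * (cmod (U i k))\<^sup>2)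
        = (\<Sum>l<n. p k l * (f (x k) + g (x k) * (y l - x k)))" ..
  qed
  also have "\<dots> \<le> (\<Sum>k<n. \<Sum>l<n. p k l * f (y l))"
    using tangent p0 by (intro sum_mono mult_left_mono) auto
  also have "\<dots> = (\<Sum>l<n. (\<Sum>k<n. p k l) * f (y l))"
    by (subst sum.swap) (simp add: sum_distrib_right)
  also have "\<dots> = (\<Sum>l<n. f (y l))" using p2 by simp
  finally show ?thesis .
qed

lemma qform_restrict:
  assumes "r \<le> n" "\<And>i. r \<le> i \<Longrightarrow> v i = 0"
  shows "qform n M v = qform r M v"
proof -
  have "(\<Sum>i<n. \<Sum>j<n. cnj (v i) * M i j * v j) = (\<Sum>i<r. \<Sum>j<n. cnj (v i) * M i j * v j)"
    by (rule sum.mono_neutral_right) (use assms in auto)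
  also have "\<dots> = (\<Sum>i<r. \<Sum>j<r. cnj (v i) * M i j * v j)"
    by (intro sum.cong refl sum.mono_neutral_right) (use assms in auto)
  finally show ?thesis by (simp add: qform_def)
qed

lemma qform_cong:
  assumes "\<And>i. i < n \<Longrightarrow> v i = w i" "\<And>i j. i < n \<Longrightarrow> j < n \<Longrightarrow> M i j = N i j"
  shows "qform n M v = qform n N w"
  using assms by (auto simp: qform_def intro!: arg_cong[of _ _ Re] sum.cong)

text \<open>For an eigenvector of the compression \<open>Y\<close>, padded by zeros,
  \<open>\<xi> j\<close> is the mean of the eigenvalues of \<open>X\<close> under the spectral
  weights of that vector, so scalar Jensen applies. In the strict case equality makes each padded
  vector an eigenvector of \<open>X\<close>, and the block beside the corner vanishes.\<close>

lemma compression_jensen: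
  fixes c e :: real
  defines "f \<equiv> \<lambda>t. c * t powr e"
  assumes E: "eigen_decomp n U x X" and F: "eigen_decomp r W \<xi> Y" and r: "r \<le> n"
    and XY: "\<And>i j. i < r \<Longrightarrow> j < r \<Longrightarrow> X i j = Y i j"
    and K: "0 \<le> c * e * (e - 1)" and x: "\<forall>k<n. 0 \<le> x k" and e: "(\<forall>k<n. 0 < x k) \<or> 0 < e"
  shows "(\<Sum>j<r. f (\<xi> j)) \<le> (\<Sum>i<r. fdiag n U x f i)"
    and "0 < c * e * (e - 1) \<Longrightarrow> (\<Sum>i<r. fdiag n U x f i) = (\<Sum>j<r. f (\<xi> j)) \<Longrightarrow>
      r \<le> i \<Longrightarrow> i < n \<Longrightarrow> t < r \<Longrightarrow> X i t = 0"
proof -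
  note UE = eigen_decompD(1)[OF E] note UF = eigen_decompD(1)[OF F]
  define w where "w = (\<lambda>j i. if i < r then W i j else 0)"
  define p where "p = (\<lambda>j k. (cmod (coord n U (w j) k))\<^sup>2)"
  have w0: "w j i = 0" if "r \<le> i" for i j using that by (simp add: w_def)
  have sum_w: "(\<Sum>i<n. h i * w j i) = (\<Sum>i<r. h i * W i j)" for h j
  proof -
    have "(\<Sum>i<n. h i * w j i) = (\<Sum>i<r. h i * w j i)"
      by (rule sum.mono_neutral_right) (use r w0 in auto)
    then show ?thesis by (simp add: w_def)
  qed
  have p0: "0 \<le> p j k" for j k by (simp add: p_def)
  have p1: "(\<Sum>k<n. p j k) = 1" if "j < r" for j
  proof -
    have "(\<Sum>k<n. p j k) = (\<Sum>i<n. (cmod (w j i))\<^sup>2)" unfolding p_def by (rule unitary_parseval[OF UE])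
    also have "\<dots> = (\<Sum>i<r. (cmod (w j i))\<^sup>2)"
      by (rule sum.mono_neutral_right) (use r w0 in auto)
    also have "\<dots> = 1" using column_norm[OF UF that] by (simp add: w_def)
    finally show ?thesis .
  qed
  have px: "(\<Sum>k<n. p j k * x k) = \<xi> j" if "j < r" for j
  proof -
    have "(\<Sum>k<n. p j k * x k) = qform n X (w j)"
      by (simp add: qform_eigen_decomp[OF E] p_def mult.commute)
    also have "\<dots> = qform r X (w j)" by (rule qform_restrict[OF r w0])
    also have "\<dots> = qform r Y (\<lambda>i. W i j)" by (rule qform_cong) (auto simp: XY w_def)
    finally show ?thesis using qform_column[OF F that] by simp
  qed
  have p2: "(\<Sum>j<r. p j k) = (\<Sum>i<r. (cmod (U i k))\<^sup>2)" for k
  proof -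
    have "p j k = (cmod (coord r W (\<lambda>i. U i k) j))\<^sup>2" for j
    proof -
      have "coord n U (w j) k = coord r U (\<lambda>i. W i j) k" by (simp add: coord_def sum_w)
      then show ?thesis unfolding p_def by (simp add: coord_swap[of r U W])
    qed
    then show ?thesis by (simp add: unitary_parseval[OF UF])
  qed
  have fd: "(\<Sum>i<r. fdiag n U x f i) = (\<Sum>j<r. \<Sum>k<n. p j k * f (x k))"
  proof -
    have "(\<Sum>i<r. fdiag n U x f i) = (\<Sum>k<n. (\<Sum>i<r. (cmod (U i k))\<^sup>2) * f (x k))"
      unfolding fdiag_def sum_distrib_right by (rule sum.swap)
    also have "\<dots> = (\<Sum>j<r. \<Sum>k<n. p j k * f (x k))"
      unfolding p2[symmetric] sum_distrib_right by (rule sum.swap)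
    finally show ?thesis .
  qed
  have xs: "\<And>k. k \<in> {..<n} \<Longrightarrow> 0 \<le> x k" "(\<forall>k\<in>{..<n}. 0 < x k) \<or> 0 < e" using x e by auto
  have jensen: "f (\<xi> j) \<le> (\<Sum>k<n. p j k * f (x k))" if "j < r" for j
    using powr_jensen(1)[of "{..<n}" c e "p j" x, OF finite_lessThan K p0 p1[OF that] xs(1) xs(2)]
    by (simp add: f_def px[OF that])
  show "(\<Sum>j<r. f (\<xi> j)) \<le> (\<Sum>i<r. fdiag n U x f i)"
    unfolding fd using jensen by (intro sum_mono) auto
  assume K': "0 < c * e * (e - 1)" and eq: "(\<Sum>i<r. fdiag n U x f i) = (\<Sum>j<r. f (\<xi> j))"
    and i: "r \<le> i" "i < n" and t: "t < r"
  have "(\<Sum>j<r. (\<Sum>k<n. p j k * f (x k)) - f (\<xi> j)) = 0"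
    using eq unfolding fd by (simp add: sum_subtractf)
  then have eqj: "(\<Sum>k<n. p j k * f (x k)) = f (\<xi> j)" if "j < r" for j
    using that sum_nonneg_eq_0_iff[of "{..<r}" "\<lambda>j. (\<Sum>k<n. p j k * f (x k)) - f (\<xi> j)"] jensen
    by auto
  have supp: "p j k = 0 \<or> x k = \<xi> j" if "j < r" "k < n" for j k
    using powr_jensen(2)[of "{..<n}" c e "p j" x, OF finite_lessThan K p0 p1[OF that(1)] xs(1) xs(2) K', of k]
      eqj[OF that(1)] that(2) by (simp add: f_def px[OF that(1)])
  \<comment> \<open>Equality puts all spectral weight of \<open>w j\<close> on the eigenvalue
    \<open>\<xi> j\<close>, so \<open>X\<close> maps it to \<open>\<xi> j\<close> times itself,
    which has no entries from \<open>r\<close> on.\<close>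
  have ev: "(\<Sum>m<r. X i m * W m j) = 0" if "j < r" for j
  proof -
    have "(\<Sum>m<r. X i m * W m j) = (\<Sum>m<n. X i m * w j m)" by (simp add: sum_w)
    also have "\<dots> = (\<Sum>k<n. of_real (x k) * U i k * coord n U (w j) k)"
      by (rule eigen_decomp_apply[OF E i(2)])
    also have "\<dots> = (\<Sum>k<n. of_real (\<xi> j) * (U i k * coord n U (w j) k))"
      using supp[OF that] by (intro sum.cong refl) (auto simp: p_def)
    also have "\<dots> = of_real (\<xi> j) * w j i"
      unfolding unitary_expand[OF UE i(2), of "w j"] by (rule sum_distrib_left[symmetric])
    finally show ?thesis using w0[OF i(1)] by simp
  qed
  have "X i t = (\<Sum>m<r. X i m * (if m = t then 1 else 0))" using t by (simp add: sum_delta_mult)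
  also have "\<dots> = (\<Sum>m<r. X i m * (\<Sum>j<r. W m j * cnj (W t j)))"
    using t by (intro sum.cong refl) (simp add: unitary_rows[OF UF])
  also have "\<dots> = (\<Sum>j<r. (\<Sum>m<r. X i m * W m j) * cnj (W t j))"
    unfolding sum_distrib_left sum_distrib_right by (subst sum.swap) (simp add: mult.assoc)
  finally show "X i t = 0" using ev by simp
qed

section \<open>Ordered pairs: gap, restriction and shift\<close>

text \<open>
  Eigenvalues are listed in increasing order (the singular values of the theorem in decreasing
  order): the leading block of size \<open>r\<close> then belongs to the \<open>r\<close> smallest eigenvalues of \<open>diag(a)\<close>.
\<close>

definition ordered_pair :: "real \<Rightarrow> nat \<Rightarrow> (nat \<Rightarrow> real) \<Rightarrow> (nat \<Rightarrow> real) \<Rightarrow> cmat \<Rightarrow> bool" where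
  "ordered_pair l n a b B \<longleftrightarrow>
    (\<forall>i j. i \<le> j \<longrightarrow> j < n \<longrightarrow> a i \<le> a j) \<and>
    (\<forall>i j. i \<le> j \<longrightarrow> j < n \<longrightarrow> b i \<le> b j) \<and> (\<forall>i<n. 0 \<le> b i) \<and>
    (\<exists>W. eigen_decomp n W b B) \<and>
    (\<forall>v. l * (\<Sum>i<n. (cmod (v i))\<^sup>2) \<le> qform n (diag_plus a (- B)) v)"

lemma ordered_pairD:
  assumes "ordered_pair l n a b B"
  shows "\<And>i j. i \<le> j \<Longrightarrow> j < n \<Longrightarrow> a i \<le> a j"
    and "\<And>i j. i \<le> j \<Longrightarrow> j < n \<Longrightarrow> b i \<le> b j"
    and "\<And>i. i < n \<Longrightarrow> 0 \<le> b i"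
    and "\<exists>W. eigen_decomp n W b B"
    and "\<And>v. l * (\<Sum>i<n. (cmod (v i))\<^sup>2) \<le> qform n (diag_plus a (- B)) v"
    and "herm n B"
    and "\<And>v. 0 \<le> qform n B v"
proof -
  show *: "\<exists>W. eigen_decomp n W b B" and b: "\<And>i. i < n \<Longrightarrow> 0 \<le> b i"
    using assms by (auto simp: ordered_pair_def)
  then show "herm n B" using eigen_decomp_herm by blast
  show "0 \<le> qform n B v" for v
    using * b by (auto simp: qform_eigen_decomp intro!: sum_nonneg)
qed (use assms in \<open>auto simp: ordered_pair_def\<close>)

lemma herm_diag_plus: "herm n B \<Longrightarrow> herm n (diag_plus a B)"
  by (rule hermI) (simp add: diag_plus_def hermD)

lemma herm_uminus: "herm n B \<Longrightarrow> herm n (- B)"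
  by (rule hermI) (simp add: hermD)

lemma ordered_pair_decomp:
  assumes "ordered_pair l n a b B"
  obtains U x V y where "eigen_decomp n U x (diag_plus a B)" "eigen_decomp n V y (diag_plus a (- B))"
    "\<And>k. k < n \<Longrightarrow> l \<le> x k" "\<And>k. k < n \<Longrightarrow> l \<le> y k"
proof -
  note D = ordered_pairD[OF assms]
  obtain U x where U: "eigen_decomp n U x (diag_plus a B)"
    using spectral_theorem[OF herm_diag_plus[OF D(6)]] by blast
  obtain V y where V: "eigen_decomp n V y (diag_plus a (- B))"
    using spectral_theorem[OF herm_diag_plus[OF herm_uminus[OF D(6)]]] by blast
  have y: "l \<le> y k" if "k < n" for k
    using D(5)[of "\<lambda>i. V i k"] qform_column[OF V that] column_norm[OF eigen_decompD(1)[OF V] that]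
    by simp
  have x: "l \<le> x k" if "k < n" for k
    using D(5)[of "\<lambda>i. U i k"] D(7)[of "\<lambda>i. U i k"] qform_column[OF U that]
      column_norm[OF eigen_decompD(1)[OF U] that]
    by (simp add: qform_diag_plus qform_uminus)
  show ?thesis by (rule that[OF U V x y])
qed

text \<open>Weyl's monotonicity for \<open>B + l \<le> diag(a)\<close>. It keeps the scalar
  arguments \<open>a i - b i\<close> in the range that holds for the eigenvalues of
  \<open>A - B\<close>.\<close>

lemma ordered_pair_gap:
  assumes P: "ordered_pair l n a b B" and i: "i < n"
  shows "l + b i \<le> a i"
proof -
  note D = ordered_pairD[OF P]
  obtain W where W: "eigen_decomp n W b B" using D(4) by blast
  show ?thesis
  proof (rule eigenvalue_comparison[OF eigen_decomp_affine(1)[OF W, of l] eigen_decomp_diag[of n a]])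
    fix v :: "nat \<Rightarrow> complex"
    show "qform n (diag_plus (\<lambda>_. l) B) v \<le> qform n (diag_plus a (\<lambda>_ _. 0)) v"
      using D(5)[of v] by (simp add: qform_diag_plus qform_uminus sum_distrib_left) (simp add: qform_def)
  qed (use D i in auto)
qed

text \<open>Padding test vectors by zeros carries the lower bound to the block; Cauchy interlacing
  raises the eigenvalues, which also keeps them nonnegative.\<close>

lemma ordered_pair_restrict:
  assumes P: "ordered_pair l n a b B" and r: "r \<le> n"
  shows "\<exists>\<beta>. ordered_pair l r a \<beta> B \<and> (\<forall>j<r. b j \<le> \<beta> j)"
proof -
  note D = ordered_pairD[OF P]
  obtain W where W: "eigen_decomp n W b B" using D(4) by blast
  have hr: "herm r B" by (rule hermI, rule hermD[OF D(6)]) (use r in auto)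
  obtain V \<beta> where V: "eigen_decomp r V \<beta> B" "\<And>i j. i \<le> j \<Longrightarrow> j < r \<Longrightarrow> \<beta> i \<le> \<beta> j"
    using spectral_theorem_sorted[OF hr] by auto
  have le: "b j \<le> \<beta> j" if "j < r" for j
    by (rule eigenvalue_comparison[OF W V(1) r D(2) V(2) _ that])
      (auto simp: qform_restrict[OF r])
  have "l * (\<Sum>i<r. (cmod (v i))\<^sup>2) \<le> qform r (diag_plus a (- B)) v" for v
  proof -
    define v' where "v' = (\<lambda>i. if i < r then v i else 0)"
    have "(\<Sum>i<n. (cmod (v' i))\<^sup>2) = (\<Sum>i<r. (cmod (v' i))\<^sup>2)"
      by (rule sum.mono_neutral_right) (use r in \<open>auto simp: v'_def\<close>)
    also have "\<dots> = (\<Sum>i<r. (cmod (v i))\<^sup>2)" by (simp add: v'_def)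
    finally have "l * (\<Sum>i<r. (cmod (v i))\<^sup>2) \<le> qform n (diag_plus a (- B)) v'"
      using D(5)[of v'] by simp
    also have "\<dots> = qform r (diag_plus a (- B)) v'"
      by (rule qform_restrict[OF r]) (simp add: v'_def)
    also have "\<dots> = qform r (diag_plus a (- B)) v" by (rule qform_cong) (auto simp: v'_def)
    finally show ?thesis .
  qed
  moreover have "0 \<le> \<beta> j" if "j < r" for j using le[OF that] D(3)[of j] r that by simp
  ultimately have "ordered_pair l r a \<beta> B"
    unfolding ordered_pair_def using V D(1) r by auto
  with le show ?thesis by blast
qed

text \<open>Used in two ways: with \<open>\<epsilon> = 0\<close> for moving along the deformation,
  where the entries only grow, and with a constant positive shift for making a semidefinite pair
  definite.\<close>

lemma ordered_pair_raise:
  assumes P: "ordered_pair l n a b B"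
    and a': "\<And>i j. i \<le> j \<Longrightarrow> j < n \<Longrightarrow> a' i \<le> a' j" "\<And>i. i < n \<Longrightarrow> a i + \<epsilon> \<le> a' i"
  shows "ordered_pair (l + \<epsilon>) n a' b B"
proof -
  note D = ordered_pairD[OF P]
  have "(l + \<epsilon>) * (\<Sum>i<n. (cmod (v i))\<^sup>2) \<le> qform n (diag_plus a' (- B)) v" for v
  proof -
    have "(\<Sum>i<n. (a i + \<epsilon>) * (cmod (v i))\<^sup>2) \<le> (\<Sum>i<n. a' i * (cmod (v i))\<^sup>2)"
      using a'(2) by (intro sum_mono mult_right_mono) auto
    then show ?thesis
      using D(5)[of v] by (simp add: qform_diag_plus algebra_simps sum.distrib sum_distrib_left)
  qed
  then show ?thesis unfolding ordered_pair_def using D a'(1) by blast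
qed

section \<open>Comparison of the two sides along the deformation\<close>

lemma trace_fun_tangent:
  fixes c e l :: real and N :: cmat
  assumes E: "eigen_decomp n U x (diag_plus a N)" "\<And>k. k < n \<Longrightarrow> l \<le> x k"
    and F: "eigen_decomp n V y (diag_plus a' N)" "\<And>k. k < n \<Longrightarrow> l \<le> y k"
    and K: "0 \<le> c * e * (e - 1)" and l: "0 \<le> l" and e: "0 < l \<or> 1 < e"
  shows "trace_fun n (\<lambda>t. c * t powr e) (diag_plus a N)
      + (\<Sum>i<n. (a' i - a i) * fun_diag n (\<lambda>t. c * e * t powr (e - 1)) (diag_plus a N) i)
    \<le> trace_fun n (\<lambda>t. c * t powr e) (diag_plus a' N)"
proof -
  have "diag_plus a' N = diag_plus (\<lambda>i. a' i - a i) (diag_plus a N)"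
    by (auto simp: diag_plus_def fun_eq_iff)
  then have F': "eigen_decomp n V y (diag_plus (\<lambda>i. a' i - a i) (diag_plus a N))"
    using F(1) by simp
  have "(\<Sum>k<n. c * x k powr e) + (\<Sum>i<n. (a' i - a i) * fdiag n U x (\<lambda>t. c * e * t powr (e - 1)) i)
      \<le> (\<Sum>k<n. c * y k powr e)"
  proof (rule klein_inequality[OF E(1) F'])
    fix k j assume "k < n" "j < n"
    then have "l \<le> x k" "l \<le> y j" using E(2) F(2) by auto
    then show "c * x k powr e + c * e * x k powr (e - 1) * (y j - x k) \<le> c * y j powr e"
      using l e by (intro powr_tangent_closed[OF K]) auto
  qed
  then show ?thesis
    unfolding trace_fun_eq[OF E(1)] trace_fun_eq[OF F(1)] using fun_diag_eq[OF E(1)] by simp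
qed

text \<open>A chain of three estimates: Jensen for the two compressions, \<open>IH\<close> on the
  block, and monotonicity of the even part from \<open>b\<close> up to the interlacing eigenvalues
  \<open>\<beta>\<close>. Equality of the ends forces it in each link: the first then splits off the
  block, the last gives \<open>b = \<beta>\<close> on it.\<close>

lemma leading_block_inequality:
  fixes c e l :: real
  defines "g \<equiv> \<lambda>t. c * t powr e"
  assumes P: "ordered_pair l n a b B" and r: "r \<le> n" and l: "0 \<le> l" and e: "0 < l \<or> 0 < e"
    and K: "0 \<le> c * e * (e - 1)"
    and IH: "\<And>\<beta>. ordered_pair l r a \<beta> B \<Longrightarrow>
      (\<Sum>i<r. g (a i + \<beta> i) + g (a i - \<beta> i))
      \<le> trace_fun r g (diag_plus a B) + trace_fun r g (diag_plus a (- B))"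
  shows "(\<Sum>i<r. g (a i + b i) + g (a i - b i))
      \<le> (\<Sum>i<r. fun_diag n g (diag_plus a B) i + fun_diag n g (diag_plus a (- B)) i)"
    and "0 < c * e * (e - 1) \<Longrightarrow>
      (\<Sum>i<r. fun_diag n g (diag_plus a B) i + fun_diag n g (diag_plus a (- B)) i)
        \<le> (\<Sum>i<r. g (a i + b i) + g (a i - b i)) \<Longrightarrow>
      (\<forall>i t. r \<le> i \<longrightarrow> i < n \<longrightarrow> t < r \<longrightarrow> B i t = 0) \<and> (\<exists>V. eigen_decomp r V b B)"
proof -
  obtain \<beta> where Q: "ordered_pair l r a \<beta> B" and \<beta>: "\<And>j. j < r \<Longrightarrow> b j \<le> \<beta> j"
    using ordered_pair_restrict[OF P r] by blast
  obtain U x V y where U: "eigen_decomp n U x (diag_plus a B)" and V: "eigen_decomp n V y (diag_plus a (- B))"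
    and xy: "\<And>k. k < n \<Longrightarrow> l \<le> x k" "\<And>k. k < n \<Longrightarrow> l \<le> y k"
    using ordered_pair_decomp[OF P] by metis
  obtain U' x' V' y' where U': "eigen_decomp r U' x' (diag_plus a B)"
    and V': "eigen_decomp r V' y' (diag_plus a (- B))"
    using ordered_pair_decomp[OF Q] by metis
  have x0: "\<forall>k<n. 0 \<le> x k" "(\<forall>k<n. 0 < x k) \<or> 0 < e"
    and y0: "\<forall>k<n. 0 \<le> y k" "(\<forall>k<n. 0 < y k) \<or> 0 < e"
    using xy l e by (fastforce intro: order_trans)+
  have JU: "(\<Sum>j<r. g (x' j)) \<le> (\<Sum>i<r. fdiag n U x g i)"
    and JV: "(\<Sum>j<r. g (y' j)) \<le> (\<Sum>i<r. fdiag n V y g i)"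
    unfolding g_def
    by (rule compression_jensen(1)[OF U U' r refl K x0] compression_jensen(1)[OF V V' r refl K y0])+
  have fd: "(\<Sum>i<r. fun_diag n g (diag_plus a B) i + fun_diag n g (diag_plus a (- B)) i)
      = (\<Sum>i<r. fdiag n U x g i) + (\<Sum>i<r. fdiag n V y g i)"
    using r by (simp add: sum.distrib fun_diag_eq[OF U] fun_diag_eq[OF V])
  have IH': "(\<Sum>i<r. g (a i + \<beta> i) + g (a i - \<beta> i)) \<le> (\<Sum>j<r. g (x' j)) + (\<Sum>j<r. g (y' j))"
    using IH[OF Q] by (simp add: trace_fun_eq[OF U'] trace_fun_eq[OF V'])
  have ev: "g (a i + b i) + g (a i - b i) \<le> g (a i + \<beta> i) + g (a i - \<beta> i)"
    "0 < c * e * (e - 1) \<Longrightarrow> g (a i + b i) + g (a i - b i) = g (a i + \<beta> i) + g (a i - \<beta> i) \<Longrightarrow> b i = \<beta> i"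
    if "i < r" for i
  proof -
    have *: "0 \<le> b i" "\<beta> i \<le> a i" "\<beta> i < a i \<or> 0 < e"
      using ordered_pair_gap[OF Q that] ordered_pairD(3)[OF P, of i] that r l e by auto
    note M = powr_even_part_mono[OF K *(1) \<beta>[OF that] *(2,3)]
    show "g (a i + b i) + g (a i - b i) \<le> g (a i + \<beta> i) + g (a i - \<beta> i)"
      "0 < c * e * (e - 1) \<Longrightarrow> g (a i + b i) + g (a i - b i) = g (a i + \<beta> i) + g (a i - \<beta> i) \<Longrightarrow> b i = \<beta> i"
      unfolding g_def using M by auto
  qed
  have s: "(\<Sum>i<r. g (a i + b i) + g (a i - b i)) \<le> (\<Sum>i<r. g (a i + \<beta> i) + g (a i - \<beta> i))"
    using ev(1) by (intro sum_mono) auto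
  show "(\<Sum>i<r. g (a i + b i) + g (a i - b i))
      \<le> (\<Sum>i<r. fun_diag n g (diag_plus a B) i + fun_diag n g (diag_plus a (- B)) i)"
    using s IH' JU JV unfolding fd by linarith
  assume K': "0 < c * e * (e - 1)"
    and eq: "(\<Sum>i<r. fun_diag n g (diag_plus a B) i + fun_diag n g (diag_plus a (- B)) i)
        \<le> (\<Sum>i<r. g (a i + b i) + g (a i - b i))"
  have eU: "(\<Sum>i<r. fdiag n U x g i) = (\<Sum>j<r. g (x' j))"
    and es: "(\<Sum>i<r. g (a i + b i) + g (a i - b i)) = (\<Sum>i<r. g (a i + \<beta> i) + g (a i - \<beta> i))"
    using eq s IH' JU JV unfolding fd by linarith+
  have "B i t = 0" if "r \<le> i" "i < n" "t < r" for i t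
    using compression_jensen(2)[OF U U' r refl K x0 K' eU[unfolded g_def] that] that
    by (simp add: diag_plus_def)
  moreover have "b i = \<beta> i" if "i < r" for i
  proof -
    have "(\<Sum>i<r. (g (a i + \<beta> i) + g (a i - \<beta> i)) - (g (a i + b i) + g (a i - b i))) = 0"
      using es by (simp only: sum_subtractf)
    then have "(g (a i + \<beta> i) + g (a i - \<beta> i)) - (g (a i + b i) + g (a i - b i)) = 0"
      using sum_nonneg_eq_0_iff[of "{..<r}"
          "\<lambda>i. (g (a i + \<beta> i) + g (a i - \<beta> i)) - (g (a i + b i) + g (a i - b i))"] ev(1) that
      by auto
    then show ?thesis using ev(2)[OF that K'] by simp
  qed
  moreover obtain W where "eigen_decomp r W \<beta> B" using ordered_pairD(4)[OF Q] by blast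
  ultimately show "(\<forall>i t. r \<le> i \<longrightarrow> i < n \<longrightarrow> t < r \<longrightarrow> B i t = 0) \<and> (\<exists>V. eigen_decomp r V b B)"
    by (auto simp: eigen_decomp_def)
qed

text \<open>
  For \<open>d\<close> the original eigenvalues of \<open>A\<close> and \<open>a\<close> those of \<open>A(s)\<close>, this compares the derivatives in
  \<open>s\<close> of the two sides of the trace inequality.
\<close>

lemma weighted_diagonal_inequality:
  fixes c e l :: real
  defines "g \<equiv> \<lambda>t. c * t powr e"
  assumes P: "ordered_pair l (Suc m) a b B" and l: "0 \<le> l" and e: "0 < l \<or> 0 < e"
    and K: "0 \<le> c * e * (e - 1)" and d: "\<And>q. q < m \<Longrightarrow> d q \<le> d (Suc q)"
    and IH: "\<And>r \<beta>. r \<le> m \<Longrightarrow> ordered_pair l r a \<beta> B \<Longrightarrow>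
      (\<Sum>i<r. g (a i + \<beta> i) + g (a i - \<beta> i))
      \<le> trace_fun r g (diag_plus a B) + trace_fun r g (diag_plus a (- B))"
  shows "(\<Sum>i<Suc m. (d m - d i) * (g (a i + b i) + g (a i - b i)))
      \<le> (\<Sum>i<Suc m. (d m - d i) *
          (fun_diag (Suc m) g (diag_plus a B) i + fun_diag (Suc m) g (diag_plus a (- B)) i))"
    and "0 < c * e * (e - 1) \<Longrightarrow>
      (\<Sum>i<Suc m. (d m - d i) *
          (fun_diag (Suc m) g (diag_plus a B) i + fun_diag (Suc m) g (diag_plus a (- B)) i))
        \<le> (\<Sum>i<Suc m. (d m - d i) * (g (a i + b i) + g (a i - b i))) \<Longrightarrow>
      q < m \<Longrightarrow> d q < d (Suc q) \<Longrightarrow>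
      (\<forall>i t. Suc q \<le> i \<longrightarrow> i < Suc m \<longrightarrow> t < Suc q \<longrightarrow> B i t = 0) \<and> (\<exists>V. eigen_decomp (Suc q) V b B)"
proof -
  let ?R = "(\<Sum>i<Suc m. (d m - d i) * (g (a i + b i) + g (a i - b i)))"
  let ?T = "(\<Sum>i<Suc m. (d m - d i) *
          (fun_diag (Suc m) g (diag_plus a B) i + fun_diag (Suc m) g (diag_plus a (- B)) i))"
  define T where "T = (\<lambda>i. fun_diag (Suc m) g (diag_plus a B) i + fun_diag (Suc m) g (diag_plus a (- B)) i)"
  define R where "R = (\<lambda>i. g (a i + b i) + g (a i - b i))"
  have block: "(\<Sum>i<Suc q. R i) \<le> (\<Sum>i<Suc q. T i)"
    "0 < c * e * (e - 1) \<Longrightarrow> (\<Sum>i<Suc q. T i) \<le> (\<Sum>i<Suc q. R i) \<Longrightarrow>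
      (\<forall>i t. Suc q \<le> i \<longrightarrow> i < Suc m \<longrightarrow> t < Suc q \<longrightarrow> B i t = 0) \<and> (\<exists>V. eigen_decomp (Suc q) V b B)"
    if "q < m" for q
    unfolding T_def R_def g_def
    by (rule leading_block_inequality[OF P _ l e K IH[unfolded g_def]]; use that in simp)+
  have mono: "(d (Suc q) - d q) * (\<Sum>i<Suc q. R i) \<le> (d (Suc q) - d q) * (\<Sum>i<Suc q. T i)"
    if "q < m" for q
    by (rule mult_left_mono[OF block(1)[OF that]]) (use d[OF that] in simp)
  have R: "?R = (\<Sum>q<m. (d (Suc q) - d q) * (\<Sum>i<Suc q. R i))"
    and T: "?T = (\<Sum>q<m. (d (Suc q) - d q) * (\<Sum>i<Suc q. T i))"
    by (simp_all only: abel_summation[symmetric] R_def T_def)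
  show "?R \<le> ?T" unfolding R T using mono by (intro sum_mono) auto
  assume K': "0 < c * e * (e - 1)" and q: "q < m" "d q < d (Suc q)" and "?T \<le> ?R"
  \<comment> \<open>The gap \<open>d (Suc q) - d q\<close> is positive, so a strict inequality in
    this one block would make the whole sum strict.\<close>
  moreover have "?R < ?T" if "(\<Sum>i<Suc q. R i) < (\<Sum>i<Suc q. T i)"
    unfolding R T
  proof (rule sum_strict_mono_ex1)
    show "\<exists>q\<in>{..<m}. (d (Suc q) - d q) * (\<Sum>i<Suc q. R i) < (d (Suc q) - d q) * (\<Sum>i<Suc q. T i)"
      using q by (intro bexI[of _ q] mult_strict_left_mono[OF that]) auto
  qed (use mono in auto)
  ultimately have "(\<Sum>i<Suc q. T i) \<le> (\<Sum>i<Suc q. R i)" by force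
  then show "(\<forall>i t. Suc q \<le> i \<longrightarrow> i < Suc m \<longrightarrow> t < Suc q \<longrightarrow> B i t = 0) \<and> (\<exists>V. eigen_decomp (Suc q) V b B)"
    by (rule block(2)[OF q(1) K'])
qed

text \<open>Along the path the difference \<open>E - R\<close> of the two sides starts at 0, and its
  formal derivative \<open>T - \<rho>\<close> is nonnegative by
  \<open>weighted_diagonal_inequality\<close>. \<open>IH\<close> is a hypothesis because two sources
  feed it: the induction for definite pairs, and the finished semidefinite inequality when equality
  is studied.\<close>

lemma path_inequality:
  fixes c e l :: real
  defines "f \<equiv> \<lambda>t. c * t powr e" and "g \<equiv> \<lambda>t. - (c * e) * t powr (e - 1)"
  assumes P: "ordered_pair l (Suc m) a b B" and l: "0 \<le> l" and e: "0 < l \<or> 1 < e"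
    and K: "c * e * (e - 1) * (e - 2) \<le> 0"
    and IH: "\<And>r \<alpha> \<beta>. r \<le> m \<Longrightarrow> ordered_pair l r \<alpha> \<beta> B \<Longrightarrow>
      (\<Sum>i<r. g (\<alpha> i + \<beta> i) + g (\<alpha> i - \<beta> i))
      \<le> trace_fun r g (diag_plus \<alpha> B) + trace_fun r g (diag_plus \<alpha> (- B))"
  shows "(\<Sum>i<Suc m. f (a i + b i) + f (a i - b i))
      \<le> trace_fun (Suc m) f (diag_plus a B) + trace_fun (Suc m) f (diag_plus a (- B))" (is ?thesis1)
    and "1 < e \<Longrightarrow> c * e * (e - 1) * (e - 2) < 0 \<Longrightarrow>
      (\<Sum>i<Suc m. f (a i + b i) + f (a i - b i))
        = trace_fun (Suc m) f (diag_plus a B) + trace_fun (Suc m) f (diag_plus a (- B)) \<Longrightarrow>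
      q < m \<Longrightarrow> a q < a (Suc q) \<Longrightarrow>
      (\<forall>i t. Suc q \<le> i \<longrightarrow> i < Suc m \<longrightarrow> t < Suc q \<longrightarrow> B i t = 0) \<and> (\<exists>V. eigen_decomp (Suc q) V b B)"
proof -
  define n where "n = Suc m"
  define C where "C = a m"
  define \<alpha> where "\<alpha> = (\<lambda>s i. C - s * (C - a i))"
  note D = ordered_pairD[OF P]
  have aC: "a i \<le> C" if "i < n" for i using D(1)[of i m] that by (simp add: C_def n_def)
  have \<alpha>_diff: "\<alpha> t i - \<alpha> s i = - ((t - s) * (C - a i))" for s t i by (simp add: \<alpha>_def algebra_simps)
  have OP: "ordered_pair l n (\<alpha> s) b B" if "0 \<le> s" "s \<le> 1" for s
  proof -
    have "ordered_pair (l + 0) (Suc m) (\<alpha> s) b B"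
    proof (rule ordered_pair_raise[OF P])
      fix i j assume "i \<le> j" "j < Suc m"
      then show "\<alpha> s i \<le> \<alpha> s j" using D(1)[of i j] that by (simp add: \<alpha>_def mult_left_mono)
    next
      fix i assume "i < Suc m"
      then have "s * (C - a i) \<le> 1 * (C - a i)" using aC[of i] that by (intro mult_right_mono) (auto simp: n_def)
      then show "a i + 0 \<le> \<alpha> s i" by (simp add: \<alpha>_def)
    qed
    then show ?thesis by (simp add: n_def)
  qed
  define E where "E = (\<lambda>s. trace_fun n f (diag_plus (\<alpha> s) B) + trace_fun n f (diag_plus (\<alpha> s) (- B)))"
  define R where "R = (\<lambda>s. \<Sum>i<n. f (\<alpha> s i + b i) + f (\<alpha> s i - b i))"
  define T where "T = (\<lambda>s. \<Sum>i<n. (C - a i) * (fun_diag n g (diag_plus (\<alpha> s) B) i + fun_diag n g (diag_plus (\<alpha> s) (- B)) i))"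
  define \<rho> where "\<rho> = (\<lambda>s. \<Sum>i<n. (C - a i) * (g (\<alpha> s i + b i) + g (\<alpha> s i - b i)))"
  have \<alpha>1: "\<alpha> 1 = a" by (auto simp: \<alpha>_def)
  have \<alpha>m: "\<alpha> s m = C" for s by (simp add: \<alpha>_def C_def)
  have e': "0 < l \<or> 0 < e - 1" using e by auto
  \<comment> \<open>Convexity of \<open>g\<close> is exactly the sign condition on
    \<open>f\<close>.\<close>
  have Kg: "0 \<le> - (c * e) * (e - 1) * (e - 1 - 1)" using K by simp
  have wdi: "\<rho> s \<le> T s"
    "0 < - (c * e) * (e - 1) * (e - 1 - 1) \<Longrightarrow> T s \<le> \<rho> s \<Longrightarrow> q < m \<Longrightarrow> a q < a (Suc q) \<Longrightarrow>
      (\<forall>i t. Suc q \<le> i \<longrightarrow> i < Suc m \<longrightarrow> t < Suc q \<longrightarrow> B i t = 0) \<and> (\<exists>V. eigen_decomp (Suc q) V b B)"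
    if "0 \<le> s" "s \<le> 1" for s q
    unfolding \<rho>_def T_def C_def n_def g_def
    by (rule weighted_diagonal_inequality[OF OP[OF that, unfolded n_def] l e' Kg _ IH[unfolded g_def]];
        use D(1) in simp)+
  have decomp: "\<exists>U x V y. eigen_decomp n U x (diag_plus (\<alpha> s) B) \<and> eigen_decomp n V y (diag_plus (\<alpha> s) (- B)) \<and>
      (\<forall>k<n. l \<le> x k) \<and> (\<forall>k<n. l \<le> y k)" if "0 \<le> s" "s \<le> 1" for s
    using ordered_pair_decomp[OF OP[OF that]] by metis
  have tangent: "trace_fun n (\<lambda>z. \<gamma> * z powr e) (diag_plus (\<alpha> s) N)
      + (\<Sum>i<n. (\<alpha> t i - \<alpha> s i) * fun_diag n (\<lambda>z. \<gamma> * e * z powr (e - 1)) (diag_plus (\<alpha> s) N) i)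
    \<le> trace_fun n (\<lambda>z. \<gamma> * z powr e) (diag_plus (\<alpha> t) N)"
    if "0 \<le> s" "s \<le> 1" "0 \<le> t" "t \<le> 1" "0 \<le> \<gamma> * e * (e - 1)" "N = B \<or> N = - B" for s t \<gamma> N
  proof -
    have "\<exists>U x. eigen_decomp n U x (diag_plus (\<alpha> s) N) \<and> (\<forall>k<n. l \<le> x k)"
      "\<exists>U x. eigen_decomp n U x (diag_plus (\<alpha> t) N) \<and> (\<forall>k<n. l \<le> x k)"
      using decomp[OF that(1,2)] decomp[OF that(3,4)] that(6) by auto
    then show ?thesis using trace_fun_tangent[OF _ _ _ _ that(5) l e] by blast
  qed
  have neg: "trace_fun n (\<lambda>z. - h z) M = - trace_fun n h M"
    "fun_diag n (\<lambda>z. - h z) M i = - fun_diag n h M i" for h M i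
    by (simp_all add: trace_fun_def fun_diag_def fdiag_def sum_negf)
  have pos: "l \<le> \<alpha> s i + b i" "l \<le> \<alpha> s i - b i" if "0 \<le> s" "s \<le> 1" "i < n" for s i
    using ordered_pair_gap[OF OP[OF that(1,2)] that(3)] D(3)[of i] that(3) by (auto simp: n_def)
  have ptangent: "\<gamma> * (\<alpha> s i + \<tau> * b i) powr e
      + (\<alpha> t i - \<alpha> s i) * (\<gamma> * e * (\<alpha> s i + \<tau> * b i) powr (e - 1)) \<le> \<gamma> * (\<alpha> t i + \<tau> * b i) powr e"
    if "0 \<le> s" "s \<le> 1" "0 \<le> t" "t \<le> 1" "0 \<le> \<gamma> * e * (e - 1)" "i < n" "\<tau> = 1 \<or> \<tau> = -1"
    for s t \<gamma> i \<tau>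
    using powr_tangent_closed[OF that(5), of "\<alpha> s i + \<tau> * b i" "\<alpha> t i + \<tau> * b i"]
      pos[OF that(1,2,6)] pos[OF that(3,4,6)] l e that(7)
    by (auto simp: mult.commute)
  \<comment> \<open>For convex \<open>f\<close> the tangent at \<open>s\<close> bounds the growth of
    \<open>E\<close> from below and the tangent at \<open>t\<close> bounds that of \<open>R\<close>
    from above; for concave \<open>f\<close> the endpoints exchange. The mismatch between
    \<open>\<rho> s\<close> and \<open>\<rho> t\<close> is absorbed by
    \<open>nondecreasing_if_small_losses\<close>.\<close>
  have step: "if 0 \<le> c * e * (e - 1)
      then (t - s) * T s \<le> E t - E s \<and> R t - R s \<le> (t - s) * \<rho> t
      else (t - s) * T t \<le> E t - E s \<and> R t - R s \<le> (t - s) * \<rho> s"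
    if s: "0 \<le> s" "s \<le> t" "t \<le> 1" for s t
  proof (cases "0 \<le> c * e * (e - 1)")
    case True
    have t1: "trace_fun n f (diag_plus (\<alpha> s) N)
        + (\<Sum>i<n. (t - s) * (C - a i) * fun_diag n g (diag_plus (\<alpha> s) N) i)
      \<le> trace_fun n f (diag_plus (\<alpha> t) N)" if "N = B \<or> N = - B" for N
      using tangent[of s t c N] s True that neg(2)[of g] by (simp add: f_def g_def \<alpha>_diff)
    have "(t - s) * T s \<le> E t - E s"
      using t1[of B] t1[of "- B"]
      by (simp add: T_def E_def sum_distrib_left sum.distrib distrib_left mult.assoc)
    moreover have "R t - R s \<le> (t - s) * \<rho> t"
      unfolding R_def \<rho>_def sum_subtractf[symmetric] sum_distrib_left
    proof (rule sum_mono)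
      fix i assume "i \<in> {..<n}"
      then show "f (\<alpha> t i + b i) + f (\<alpha> t i - b i) - (f (\<alpha> s i + b i) + f (\<alpha> s i - b i))
          \<le> (t - s) * ((C - a i) * (g (\<alpha> t i + b i) + g (\<alpha> t i - b i)))"
        using ptangent[of t s c i 1] ptangent[of t s c i "-1"] s True \<alpha>_diff[of s i t]
        by (simp add: f_def g_def algebra_simps)
    qed
    ultimately show ?thesis using True by simp
  next
    case False
    then have F: "0 \<le> - c * e * (e - 1)" by simp
    have t1: "trace_fun n f (diag_plus (\<alpha> s) N)
        + (\<Sum>i<n. (t - s) * (C - a i) * fun_diag n g (diag_plus (\<alpha> t) N) i)
      \<le> trace_fun n f (diag_plus (\<alpha> t) N)" if "N = B \<or> N = - B" for N
      using tangent[of t s "- c" N] s F that neg(1)[of f]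
      by (simp add: f_def g_def \<alpha>_diff[of s _ t] sum_negf algebra_simps)
    have "(t - s) * T t \<le> E t - E s"
      using t1[of B] t1[of "- B"]
      by (simp add: T_def E_def sum_distrib_left sum.distrib distrib_left mult.assoc)
    moreover have "R t - R s \<le> (t - s) * \<rho> s"
      unfolding R_def \<rho>_def sum_subtractf[symmetric] sum_distrib_left
    proof (rule sum_mono)
      fix i assume "i \<in> {..<n}"
      then show "f (\<alpha> t i + b i) + f (\<alpha> t i - b i) - (f (\<alpha> s i + b i) + f (\<alpha> s i - b i))
          \<le> (t - s) * ((C - a i) * (g (\<alpha> s i + b i) + g (\<alpha> s i - b i)))"
        using ptangent[of s t "- c" i 1] ptangent[of s t "- c" i "-1"] s F \<alpha>_diff[of t i s]
        by (simp add: f_def g_def algebra_simps)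
    qed
    ultimately show ?thesis using False by simp
  qed
  have mono: "E s - R s \<le> E t - R t" if st: "0 \<le> s" "s \<le> t" "t \<le> 1" for s t
  proof (cases "0 \<le> c * e * (e - 1)")
    case True
    show ?thesis
    proof (rule nondecreasing_if_small_losses[where \<rho> = \<rho>, OF st(2)])
      fix u v assume uv: "s \<le> u" "u \<le> v" "v \<le> t"
      have "(v - u) * \<rho> u \<le> (v - u) * T u" using wdi(1)[of u] uv st by (intro mult_left_mono) auto
      then show "(v - u) * (\<rho> u - \<rho> v) \<le> E v - R v - (E u - R u)"
        using step[of u v] uv st True by (simp add: algebra_simps)
    qed
  next
    case False
    show ?thesis
    proof (rule nondecreasing_if_small_losses[where \<rho> = "\<lambda>s. - \<rho> s", OF st(2)])
      fix u v assume uv: "s \<le> u" "u \<le> v" "v \<le> t"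
      have "(v - u) * \<rho> v \<le> (v - u) * T v" using wdi(1)[of v] uv st by (intro mult_left_mono) auto
      then show "(v - u) * (- \<rho> u - - \<rho> v) \<le> E v - R v - (E u - R u)"
        using step[of u v] uv st False by (simp add: algebra_simps)
    qed
  qed
  \<comment> \<open>At \<open>s = 0\<close> the deformed matrix is \<open>C\<close> times the
    identity, so one eigenbasis of \<open>B\<close> serves both signs.\<close>
  have start: "E 0 = R 0"
  proof -
    obtain W where W: "eigen_decomp n W b B" using D(4) by (auto simp: n_def)
    have "\<alpha> 0 = (\<lambda>_. C)" by (auto simp: \<alpha>_def)
    then show ?thesis
      by (simp add: E_def R_def trace_fun_eq[OF eigen_decomp_affine(1)[OF W]]
          trace_fun_eq[OF eigen_decomp_affine(2)[OF W]] sum.distrib)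
  qed
  show ?thesis1
    using mono[of 0 1] start by (simp add: E_def R_def \<alpha>1 n_def del: sum.lessThan_Suc)
  assume e1: "1 < e" and K': "c * e * (e - 1) * (e - 2) < 0" and q: "q < m" "a q < a (Suc q)"
    and eq: "(\<Sum>i<Suc m. f (a i + b i) + f (a i - b i))
        = trace_fun (Suc m) f (diag_plus a B) + trace_fun (Suc m) f (diag_plus a (- B))"
  have "E 1 = R 1" using eq by (simp add: E_def R_def \<alpha>1 n_def del: sum.lessThan_Suc)
  then have ER: "E s = R s" if "0 \<le> s" "s \<le> 1" for s
    using mono[of 0 s] mono[of s 1] that start by simp
  \<comment> \<open>An argument of the power may vanish, so continuity relies on
    \<open>e - 1\<close> being positive.\<close>
  have lim: "(\<lambda>k. \<rho> (\<tau> k)) \<longlonglongrightarrow> \<rho> (1/2)" if \<tau>: "\<And>k. 0 \<le> \<tau> k" "\<And>k. \<tau> k \<le> 1" "\<tau> \<longlonglongrightarrow> 1/2" for \<tau> :: "nat \<Rightarrow> real"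
  proof -
    have \<alpha>lim: "(\<lambda>k. \<alpha> (\<tau> k) i) \<longlonglongrightarrow> \<alpha> (1/2) i" for i
      unfolding \<alpha>_def by (intro tendsto_intros \<tau>)
    have plim: "(\<lambda>k. (\<alpha> (\<tau> k) i + z) powr (e - 1)) \<longlonglongrightarrow> (\<alpha> (1/2) i + z) powr (e - 1)"
      if "\<And>k. 0 \<le> \<alpha> (\<tau> k) i + z" for i z
      by (rule tendsto_powr'[OF tendsto_add[OF \<alpha>lim tendsto_const] tendsto_const]) (use e1 that in auto)
    have lims: "(\<lambda>k. (\<alpha> (\<tau> k) i + b i) powr (e - 1)) \<longlonglongrightarrow> (\<alpha> (1/2) i + b i) powr (e - 1)"
      "(\<lambda>k. (\<alpha> (\<tau> k) i - b i) powr (e - 1)) \<longlonglongrightarrow> (\<alpha> (1/2) i - b i) powr (e - 1)" if "i < n" for i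
      using plim[of i "b i"] plim[of i "- b i"] order_trans[OF l pos(1)[OF \<tau>(1,2) that]]
        order_trans[OF l pos(2)[OF \<tau>(1,2) that]] by simp_all
    show ?thesis
      unfolding \<rho>_def g_def by (intro tendsto_sum tendsto_mult tendsto_add tendsto_const lims) auto
  qed
  have inv: "(\<lambda>k. 1/2 * inverse (real (Suc k))) \<longlonglongrightarrow> 1/2 * 0"
    by (intro tendsto_mult tendsto_const LIMSEQ_inverse_real_of_nat)
  have inv01: "0 < inverse (real (Suc k))" "inverse (real (Suc k)) \<le> 1" for k
    by (auto simp: inverse_le_1_iff)
  \<comment> \<open>Any interior point would do. Equality along the path gives
    \<open>T (1/2) \<le> \<rho> (\<tau> k)\<close> at points approaching from the right for convex
    \<open>f\<close>, from the left for concave \<open>f\<close>; the limit uses continuity of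
    \<open>\<rho>\<close> and asks nothing of \<open>T\<close>.\<close>
  have "T (1/2) \<le> \<rho> (1/2)"
  proof (cases "0 \<le> c * e * (e - 1)")
    case True
    define \<tau> where "\<tau> = (\<lambda>k. 1/2 + 1/2 * inverse (real (Suc k)))"
    have \<tau>: "0 \<le> \<tau> k" "\<tau> k \<le> 1" "\<tau> k > 1/2" for k
      using inv01[of k] unfolding \<tau>_def by linarith+
    have "T (1/2) \<le> \<rho> (\<tau> k)" for k
    proof -
      have "(\<tau> k - 1/2) * T (1/2) \<le> E (\<tau> k) - E (1/2)"
        "R (\<tau> k) - R (1/2) \<le> (\<tau> k - 1/2) * \<rho> (\<tau> k)"
        using step[of "1/2" "\<tau> k"] \<tau>[of k] True by simp_all
      then have "(\<tau> k - 1/2) * T (1/2) \<le> (\<tau> k - 1/2) * \<rho> (\<tau> k)"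
        using \<tau>[of k] ER[of "1/2"] ER[of "\<tau> k"] by linarith
      then show ?thesis using \<tau>(3)[of k] by (simp add: mult_le_cancel_left_pos)
    qed
    moreover have "(\<lambda>k. \<rho> (\<tau> k)) \<longlonglongrightarrow> \<rho> (1/2)"
    proof (rule lim)
      show "\<tau> \<longlonglongrightarrow> 1/2" using tendsto_add[OF tendsto_const inv, of "1/2"] by (simp add: \<tau>_def)
    qed (rule \<tau>)+
    ultimately show ?thesis by (intro LIMSEQ_le_const) auto
  next
    case False
    define \<tau> where "\<tau> = (\<lambda>k. 1/2 - 1/2 * inverse (real (Suc k)))"
    have \<tau>: "0 \<le> \<tau> k" "\<tau> k \<le> 1" "\<tau> k < 1/2" for k
      using inv01[of k] unfolding \<tau>_def by linarith+
    have "T (1/2) \<le> \<rho> (\<tau> k)" for k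
    proof -
      have "(1/2 - \<tau> k) * T (1/2) \<le> E (1/2) - E (\<tau> k)"
        "R (1/2) - R (\<tau> k) \<le> (1/2 - \<tau> k) * \<rho> (\<tau> k)"
        using step[of "\<tau> k" "1/2"] \<tau>[of k] False by simp_all
      then have "(1/2 - \<tau> k) * T (1/2) \<le> (1/2 - \<tau> k) * \<rho> (\<tau> k)"
        using \<tau>[of k] ER[of "1/2"] ER[of "\<tau> k"] by linarith
      then show ?thesis using \<tau>(3)[of k] by (simp add: mult_le_cancel_left_pos)
    qed
    moreover have "(\<lambda>k. \<rho> (\<tau> k)) \<longlonglongrightarrow> \<rho> (1/2)"
    proof (rule lim)
      show "\<tau> \<longlonglongrightarrow> 1/2" using tendsto_diff[OF tendsto_const inv, of "1/2"] by (simp add: \<tau>_def)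
    qed (rule \<tau>)+
    ultimately show ?thesis by (intro LIMSEQ_le_const) auto
  qed
  then show "(\<forall>i t. Suc q \<le> i \<longrightarrow> i < Suc m \<longrightarrow> t < Suc q \<longrightarrow> B i t = 0) \<and> (\<exists>V. eigen_decomp (Suc q) V b B)"
    using wdi(2)[of "1/2" q] q K' by simp
qed

section \<open>The trace inequality for definite and semidefinite pairs\<close>

lemma trace_inequality_definite:
  assumes "ordered_pair l n a b B" and "0 < l" and "e \<le> 3" and "c * e * (e - 1) * (e - 2) \<le> 0"
  shows "(\<Sum>i<n. c * (a i + b i) powr e + c * (a i - b i) powr e)
    \<le> trace_fun n (\<lambda>t. c * t powr e) (diag_plus a B) + trace_fun n (\<lambda>t. c * t powr e) (diag_plus a (- B))"
  using assms
\<comment> \<open>\<open>c\<close> and \<open>e\<close> vary because the hypothesis is applied to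
  \<open>g\<close>; \<open>l\<close> stays fixed because restriction to a block keeps the
  bound.\<close>
proof (induction n arbitrary: a b c e rule: less_induct)
  case (less n)
  show ?case
  proof (cases n)
    case 0
    then show ?thesis by (simp add: trace_fun_def)
  next
    case (Suc m)
    have "c * e * (e - 1) * (e - 2) * (3 - e) \<le> 0"
      by (rule mult_nonpos_nonneg) (use less.prems(3,4) in auto)
    then have K: "- (c * e) * (e - 1) * (e - 1 - 1) * (e - 1 - 2) \<le> 0"
      by (simp add: algebra_simps)
    show ?thesis
      unfolding Suc
    proof (rule path_inequality(1)[OF less.prems(1)[unfolded Suc] _ _ less.prems(4)])
      fix r \<alpha> \<beta> assume "r \<le> m" "ordered_pair l r \<alpha> \<beta> B"
      then show "(\<Sum>i<r. - (c * e) * (\<alpha> i + \<beta> i) powr (e - 1) + - (c * e) * (\<alpha> i - \<beta> i) powr (e - 1))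
          \<le> trace_fun r (\<lambda>t. - (c * e) * t powr (e - 1)) (diag_plus \<alpha> B)
            + trace_fun r (\<lambda>t. - (c * e) * t powr (e - 1)) (diag_plus \<alpha> (- B))"
        by (intro less.IH[OF _ _ less.prems(2) _ K]) (use less.prems Suc in auto)
    qed (use less.prems in auto)
  qed
qed

text \<open>Adding \<open>\<epsilon>\<close> to \<open>A\<close> shifts the eigenvalues of
  \<open>A + B\<close> and \<open>A - B\<close> by \<open>\<epsilon>\<close>, and a power with
  positive exponent is continuous at 0, so the definite case passes to the limit.\<close>

lemma trace_inequality_semidefinite:
  assumes P: "ordered_pair 0 n a b B" and e: "0 < e" "e \<le> 3" and K: "c * e * (e - 1) * (e - 2) \<le> 0"
  shows "(\<Sum>i<n. c * (a i + b i) powr e + c * (a i - b i) powr e)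
    \<le> trace_fun n (\<lambda>t. c * t powr e) (diag_plus a B) + trace_fun n (\<lambda>t. c * t powr e) (diag_plus a (- B))"
proof -
  obtain U x V y where U: "eigen_decomp n U x (diag_plus a B)" and V: "eigen_decomp n V y (diag_plus a (- B))"
    and xy: "\<And>k. k < n \<Longrightarrow> 0 \<le> x k" "\<And>k. k < n \<Longrightarrow> 0 \<le> y k"
    using ordered_pair_decomp[OF P] by metis
  define \<epsilon> where "\<epsilon> = (\<lambda>k. inverse (real (Suc k)))"
  have \<epsilon>: "\<epsilon> \<longlonglongrightarrow> 0" unfolding \<epsilon>_def by (rule LIMSEQ_inverse_real_of_nat)
  have shift: "diag_plus (\<lambda>i. a i + \<epsilon> k) N = diag_plus (\<lambda>_. \<epsilon> k) (diag_plus a N)" for k N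
    by (auto simp: diag_plus_def fun_eq_iff)
  have "(\<Sum>i<n. c * (\<epsilon> k + (a i + b i)) powr e + c * (\<epsilon> k + (a i - b i)) powr e)
      \<le> (\<Sum>i<n. c * (\<epsilon> k + x i) powr e) + (\<Sum>i<n. c * (\<epsilon> k + y i) powr e)" for k
  proof -
    have "ordered_pair (0 + \<epsilon> k) n (\<lambda>i. a i + \<epsilon> k) b B"
      using ordered_pairD(1)[OF P] by (intro ordered_pair_raise[OF P]) auto
    moreover have "0 < 0 + \<epsilon> k" by (simp add: \<epsilon>_def)
    ultimately have I: "(\<Sum>i<n. c * (a i + \<epsilon> k + b i) powr e + c * (a i + \<epsilon> k - b i) powr e)
        \<le> trace_fun n (\<lambda>t. c * t powr e) (diag_plus (\<lambda>i. a i + \<epsilon> k) B)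
          + trace_fun n (\<lambda>t. c * t powr e) (diag_plus (\<lambda>i. a i + \<epsilon> k) (- B))"
      by (rule trace_inequality_definite[OF _ _ e(2) K])
    have "a i + \<epsilon> k + b i = \<epsilon> k + (a i + b i)" "a i + \<epsilon> k - b i = \<epsilon> k + (a i - b i)" for i by auto
    with I show ?thesis
      by (simp only: shift trace_fun_eq[OF eigen_decomp_affine(1)[OF U]]
          trace_fun_eq[OF eigen_decomp_affine(1)[OF V]])
  qed
  moreover have lim: "(\<lambda>k. (\<epsilon> k + z) powr e) \<longlonglongrightarrow> z powr e" if "0 \<le> z" for z
  proof -
    have "(\<lambda>k. (\<epsilon> k + z) powr e) \<longlonglongrightarrow> (0 + z) powr e"
      using e that by (intro tendsto_powr' tendsto_intros \<epsilon> disjI2 conjI always_eventually allI) (auto simp: \<epsilon>_def)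
    then show ?thesis by simp
  qed
  have "0 \<le> a i + b i" "0 \<le> a i - b i" if "i < n" for i
    using ordered_pair_gap[OF P that] ordered_pairD(3)[OF P that] by auto
  then have "(\<lambda>k. \<Sum>i<n. c * (\<epsilon> k + (a i + b i)) powr e + c * (\<epsilon> k + (a i - b i)) powr e)
      \<longlonglongrightarrow> (\<Sum>i<n. c * (a i + b i) powr e + c * (a i - b i) powr e)"
    by (intro tendsto_intros lim) auto
  moreover have "(\<lambda>k. (\<Sum>i<n. c * (\<epsilon> k + x i) powr e) + (\<Sum>i<n. c * (\<epsilon> k + y i) powr e))
      \<longlonglongrightarrow> (\<Sum>i<n. c * x i powr e) + (\<Sum>i<n. c * y i powr e)"
    using xy by (intro tendsto_intros lim) auto
  ultimately show ?thesis
    unfolding trace_fun_eq[OF U] trace_fun_eq[OF V] by (intro LIMSEQ_le) auto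
qed

section \<open>The case of equality\<close>

text \<open>Here \<open>path_inequality\<close> is applied at \<open>l = 0\<close> itself. Its
  hypothesis on \<open>g\<close> is the semidefinite inequality, available because the exponent
  \<open>e - 1\<close> is positive.\<close>

lemma equality_imp_blocks:
  assumes P: "ordered_pair 0 n a b B" and e: "1 < e" "e \<le> 3" and K: "c * e * (e - 1) * (e - 2) < 0"
    and eq: "(\<Sum>i<n. c * (a i + b i) powr e + c * (a i - b i) powr e)
      = trace_fun n (\<lambda>t. c * t powr e) (diag_plus a B) + trace_fun n (\<lambda>t. c * t powr e) (diag_plus a (- B))"
    and q: "Suc q < n" "a q < a (Suc q)"
  shows "(\<forall>i t. Suc q \<le> i \<longrightarrow> i < n \<longrightarrow> t < Suc q \<longrightarrow> B i t = 0) \<and> (\<exists>V. eigen_decomp (Suc q) V b B)"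
proof -
  obtain m where n: "n = Suc m" using q(1) by (cases n) auto
  have "c * e * (e - 1) * (e - 2) * (3 - e) \<le> 0"
    by (rule mult_nonpos_nonneg) (use K e in auto)
  then have K': "- (c * e) * (e - 1) * (e - 1 - 1) * (e - 1 - 2) \<le> 0"
    by (simp add: algebra_simps)
  show ?thesis
    unfolding n
  proof (rule path_inequality(2)[OF P[unfolded n] order_refl _ _ _ e(1) K eq[unfolded n]])
    fix r \<alpha> \<beta> assume "r \<le> m" "ordered_pair 0 r \<alpha> \<beta> B"
    then show "(\<Sum>i<r. - (c * e) * (\<alpha> i + \<beta> i) powr (e - 1) + - (c * e) * (\<alpha> i - \<beta> i) powr (e - 1))
        \<le> trace_fun r (\<lambda>t. - (c * e) * t powr (e - 1)) (diag_plus \<alpha> B)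
          + trace_fun r (\<lambda>t. - (c * e) * t powr (e - 1)) (diag_plus \<alpha> (- B))"
      by (intro trace_inequality_semidefinite[OF _ _ _ K']) (use e in auto)
  qed (use e q n K in auto)
qed

text \<open>Meant for \<open>N = B\<close>, \<open>h \<alpha> z = \<alpha> + z\<close> and for
  \<open>N = - B\<close>, \<open>h \<alpha> z = \<alpha> - z\<close>. The blocks make
  \<open>N\<close> vanish between different levels of \<open>a\<close>; on one level
  \<open>diag(a)\<close> is scalar, so the diagonal entries are those of a function of
  \<open>B\<close>. Inside a level \<open>B\<close> need not be diagonal: only the sums of
  \<open>\<Delta>\<close> up to the jumps of \<open>a\<close> vanish, and this suffices for the
  trace.\<close>

lemma trace_fun_commuting:
  assumes N: "\<And>\<alpha>. eigen_decomp n W (\<lambda>k. h \<alpha> (b k)) (diag_plus (\<lambda>_. \<alpha>) N)"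
    and W: "eigen_decomp n W b B" and hN: "herm n N"
    and a: "\<And>i j. i \<le> j \<Longrightarrow> j < n \<Longrightarrow> a i \<le> a j"
    and NB: "\<And>i j. B i j = 0 \<Longrightarrow> N i j = 0"
    and blocks: "\<And>q. Suc q < n \<Longrightarrow> a q < a (Suc q) \<Longrightarrow>
      (\<forall>i t. Suc q \<le> i \<longrightarrow> i < n \<longrightarrow> t < Suc q \<longrightarrow> B i t = 0) \<and> (\<exists>V. eigen_decomp (Suc q) V b B)"
  shows "trace_fun n f (diag_plus a N) = (\<Sum>i<n. f (h (a i) (b i)))"
proof -
  have hB: "herm n B" by (rule eigen_decomp_herm[OF W])
  define \<Delta> where "\<Delta> = (\<lambda>g i. fdiag n W b g i - g (b i))"
  have full: "(\<Sum>i<n. \<Delta> g i) = 0" for g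
    by (simp add: \<Delta>_def sum_subtractf sum_fdiag[OF eigen_decompD(1)[OF W]])
  have gap: "(\<Sum>i<Suc q. \<Delta> g i) = 0" if q: "Suc q < n" "a q < a (Suc q)" for q g
  proof -
    obtain V where V: "eigen_decomp (Suc q) V b B" using blocks[OF q] by blast
    have z: "B i t = 0" if "Suc q \<le> i" "i < n" "t < Suc q" for i t using blocks[OF q] that by blast
    have "fdiag n W b g i = fdiag (Suc q) V b g i" if "i < Suc q" for i
    proof (rule fdiag_reducing_block[OF W V, of "{..<Suc q}"])
      fix j k assume "j \<in> {..<Suc q}" "k < n" "k \<notin> {..<Suc q}"
      then show "B j k = 0" using hermD[OF hB, of k j] z[of k j] q(1) by simp
    qed (use that q in auto)
    then show ?thesis
      by (simp add: \<Delta>_def sum_subtractf sum_fdiag[OF eigen_decompD(1)[OF V]] del: sum.lessThan_Suc)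
  qed
  have off: "N j k = 0" if "j < n" "k < n" "a j \<noteq> a k" for j k
  proof -
    have low: "B k j = 0" if jk: "a j < a k" "k < n" "j < n" for j k
    proof -
      \<comment> \<open>\<open>r\<close> is the first index above the level of \<open>a j\<close>;
        the jump just before it separates \<open>j\<close> from \<open>k\<close>.\<close>
      define r where "r = (LEAST r. a j < a r)"
      have r: "a j < a r" unfolding r_def by (rule LeastI[of _ k]) (rule jk)
      have rk: "r \<le> k" unfolding r_def by (rule Least_le) (rule jk)
      have jr: "j < r" using a[of r j] r jk by (cases "r \<le> j") auto
      then obtain p where p: "r = Suc p" by (cases r) auto
      have "\<not> a j < a p" using not_less_Least[of p "\<lambda>r. a j < a r"] p by (simp add: r_def)
      then have "a p < a (Suc p)" using r p by simp
      with blocks[of p] show ?thesis using rk jk jr p by auto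
    qed
    have "B j k = 0"
      using low[of j k] low[of k j] hermD[OF hB, of k j] that by (cases "a j < a k") auto
    then show ?thesis by (rule NB)
  qed
  obtain U x where U: "eigen_decomp n U x (diag_plus a N)"
    using spectral_theorem[OF herm_diag_plus[OF hN]] by blast
  have loc: "fdiag n U x f i = fdiag n W b (\<lambda>z. f (h (a i) z)) i" if i: "i < n" for i
  proof -
    have "fdiag n U x f i = fdiag n W (\<lambda>k. h (a i) (b k)) f i"
      by (rule fdiag_reducing_block[OF U N, of "{j. j < n \<and> a j = a i}"])
        (use i off in \<open>auto simp: diag_plus_def\<close>)
    then show ?thesis by (simp add: fdiag_def)
  qed
  \<comment> \<open>At a jump of \<open>a\<close> the partial sum vanishes for every function, so
    the function of one level may be exchanged for that of the next; between jumps it does not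
    change.\<close>
  have abel: "(\<Sum>i<Suc q. \<Delta> (\<lambda>z. f (h (a i) z)) i) = (\<Sum>i<Suc q. \<Delta> (\<lambda>z. f (h (a q) z)) i)" if "q < n" for q
    using that
  proof (induction q)
    case (Suc q)
    then have IH: "(\<Sum>i<Suc q. \<Delta> (\<lambda>z. f (h (a i) z)) i) = (\<Sum>i<Suc q. \<Delta> (\<lambda>z. f (h (a q) z)) i)" by simp
    show ?case
    proof (cases "a q < a (Suc q)")
      case True
      then show ?thesis
        using IH gap[OF Suc.prems True]
        by (simp only: sum.lessThan_Suc[of _ "Suc q"])
    next
      case False
      then have "a (Suc q) = a q" using a[of q "Suc q"] Suc.prems by simp
      then show ?thesis using IH by (simp only: sum.lessThan_Suc[of _ "Suc q"])
    qed
  qed simp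
  have "(\<Sum>i<n. \<Delta> (\<lambda>z. f (h (a i) z)) i) = 0"
  proof (cases n)
    case (Suc m)
    then show ?thesis using abel[of m] full by simp
  qed simp
  then show ?thesis
    unfolding trace_fun_eq[OF U] sum_fdiag[OF eigen_decompD(1)[OF U], symmetric]
    by (simp add: \<Delta>_def sum_subtractf loc)
qed

text \<open>Equality for one exponent fixes the relative position of the eigenspaces, and that
  position gives equality for an arbitrary function.\<close>

lemma trace_fun_eq_if_powr_eq:
  assumes P: "ordered_pair 0 n a b B" and e: "1 < e" "e \<le> 3" "e \<noteq> 2"
    and eq: "trace_fun n (\<lambda>t. t powr e) (diag_plus a B) + trace_fun n (\<lambda>t. t powr e) (diag_plus a (- B))
      = (\<Sum>i<n. (a i + b i) powr e + (a i - b i) powr e)"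
  shows "trace_fun n f (diag_plus a B) + trace_fun n f (diag_plus a (- B))
      = (\<Sum>i<n. f (a i + b i) + f (a i - b i))"
proof -
  note D = ordered_pairD[OF P]
  obtain W where W: "eigen_decomp n W b B" using D(4) by blast
  \<comment> \<open>The sign makes the class condition strict on either side of 2.\<close>
  define c :: real where "c = (if e < 2 then 1 else -1)"
  have "0 < e * (e - 1)" using e by simp
  then have K: "c * e * (e - 1) * (e - 2) < 0"
    using e by (auto simp: c_def mult_pos_neg)
  have scale: "trace_fun n (\<lambda>t. c * t powr e) M = c * trace_fun n (\<lambda>t. t powr e) M" for M
    by (simp add: trace_fun_def sum_distrib_left)
  have eq': "(\<Sum>i<n. c * (a i + b i) powr e + c * (a i - b i) powr e)
      = trace_fun n (\<lambda>t. c * t powr e) (diag_plus a B) + trace_fun n (\<lambda>t. c * t powr e) (diag_plus a (- B))"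
    unfolding scale distrib_left[symmetric] eq sum_distrib_left ..
  note blocks = equality_imp_blocks[OF P e(1,2) K eq']
  have "trace_fun n f (diag_plus a B) = (\<Sum>i<n. f (a i + b i))"
    by (rule trace_fun_commuting[OF eigen_decomp_affine(1)[OF W] W D(6) D(1) _ blocks])
  moreover have "trace_fun n f (diag_plus a (- B)) = (\<Sum>i<n. f (a i - b i))"
    by (rule trace_fun_commuting[OF eigen_decomp_affine(2)[OF W] W herm_uminus[OF D(6)] D(1) _ blocks]) auto
  ultimately show ?thesis by (simp add: sum.distrib)
qed

section \<open>Schatten norms and singular values\<close>

definition entries :: "complex mat \<Rightarrow> cmat" where
  "entries A i j = A $$ (i, j)"

section \<open>Translation between matrix objects and index functions\<close>

lemma mat_adjoint_carrier:
  assumes "A \<in> carrier_mat n m"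
  shows "mat_adjoint A \<in> carrier_mat m n"
  using assms by (auto simp: mat_adjoint_def mat_of_rows_def)

lemma mat_adjoint_index:
  assumes "A \<in> carrier_mat n m" "i < m" "j < n"
  shows "mat_adjoint A $$ (i, j) = cnj (A $$ (j, i))"
  using assms by (simp add: mat_adjoint_def mat_of_rows_def)

lemma mat_mult_index:
  assumes "A \<in> carrier_mat n k" "B \<in> carrier_mat k m" "i < n" "j < m"
  shows "(A * B) $$ (i, j) = (\<Sum>l<k. A $$ (i, l) * B $$ (l, j))"
  using assms by (simp add: scalar_prod_def lessThan_atLeast0)

lemma herm_entries:
  assumes "A \<in> carrier_mat n n" "hermitian_mat A"
  shows "herm n (entries A)"
proof (rule hermI)
  fix i j assume "i < n" "j < n"
  then show "cnj (entries A i j) = entries A j i"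
    using mat_adjoint_index[OF assms(1), of j i] assms(2) by (simp add: entries_def hermitian_mat_def)
qed

lemma psd_mat_qform:
  assumes A: "A \<in> carrier_mat n n" "psd_mat A"
  shows "0 \<le> qform n (entries A) v"
proof -
  let ?v = "vec n v"
  have "(A *\<^sub>v ?v) \<bullet>c ?v = (\<Sum>i<n. (\<Sum>j<n. A $$ (i, j) * v j) * cnj (v i))"
    using A(1) by (simp add: scalar_prod_def lessThan_atLeast0)
  also have "\<dots> = (\<Sum>i<n. \<Sum>j<n. cnj (v i) * entries A i j * v j)"
    by (simp add: entries_def sum_distrib_left sum_distrib_right mult_ac)
  finally have "(A *\<^sub>v ?v) \<bullet>c ?v = (\<Sum>i<n. \<Sum>j<n. cnj (v i) * entries A i j * v j)" .
  moreover have "(A *\<^sub>v ?v) \<bullet>c ?v \<ge> 0" using A by (auto simp: psd_mat_def)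
  ultimately show ?thesis by (simp add: qform_def less_eq_complex_def)
qed

lemma unitary_spectral_index:
  assumes U: "U \<in> carrier_mat n n" and ij: "i < n" "j < n"
  shows "(U * mat_diag n d * mat_adjoint U) $$ (i, j)
    = (\<Sum>k<n. d k * (U $$ (i, k) * cnj (U $$ (j, k))))"
proof -
  have "U * mat_diag n d \<in> carrier_mat n n" using U by auto
  then have "(U * mat_diag n d * mat_adjoint U) $$ (i, j)
      = (\<Sum>k<n. (U * mat_diag n d) $$ (i, k) * mat_adjoint U $$ (k, j))"
    using mat_adjoint_carrier[OF U] ij by (rule mat_mult_index)
  also have "\<dots> = (\<Sum>k<n. d k * (U $$ (i, k) * cnj (U $$ (j, k))))"
    using U ij by (intro sum.cong refl) (simp add: mat_diag_mult_right[OF U] mat_adjoint_index[OF U] mult_ac)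
  finally show ?thesis .
qed

lemma eigen_decomp_of_mat:
  assumes U: "U \<in> carrier_mat n n" "unitary_mat U"
    and A: "A = U * mat_diag n (\<lambda>i. complex_of_real (d i)) * mat_adjoint U"
  shows "eigen_decomp n (entries U) d (entries A)"
proof -
  have un: "unitary_fun n (entries U)"
  proof (rule unitary_funI)
    fix j k assume jk: "j < n" "k < n"
    have "(mat_adjoint U * U) $$ (j, k) = (\<Sum>i<n. mat_adjoint U $$ (j, i) * U $$ (i, k))"
      using mat_adjoint_carrier[OF U(1)] U(1) jk by (rule mat_mult_index)
    also have "\<dots> = (\<Sum>i<n. cnj (entries U i j) * entries U i k)"
      using jk by (simp add: mat_adjoint_index[OF U(1)] entries_def)
    finally show "(\<Sum>i<n. cnj (entries U i j) * entries U i k) = (if j = k then 1 else 0)"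
      using U jk by (simp add: unitary_mat_def)
  qed
  moreover have "(\<Sum>j<n. entries A i j * entries U j k) = of_real (d k) * entries U i k"
    if ik: "i < n" "k < n" for i k
  proof -
    have "(\<Sum>j<n. entries A i j * entries U j k)
        = (\<Sum>j<n. \<Sum>m<n. of_real (d m) * entries U i m * (cnj (entries U j m) * entries U j k))"
      unfolding A entries_def using ik
      by (intro sum.cong refl) (simp add: unitary_spectral_index[OF U(1)] sum_distrib_left sum_distrib_right mult_ac)
    also have "\<dots> = (\<Sum>m<n. of_real (d m) * entries U i m * (\<Sum>j<n. cnj (entries U j m) * entries U j k))"
      unfolding sum_distrib_left by (rule sum.swap)
    also have "\<dots> = (\<Sum>m<n. of_real (d m) * entries U i m * (if m = k then 1 else 0))"
      using ik by (intro sum.cong refl) (simp add: unitary_cols[OF un])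
    finally show ?thesis using ik by (simp only: sum_delta_mult)
  qed
  ultimately show ?thesis by (simp add: eigen_decomp_def)
qed

lemma eigen_decomp_to_mat:
  assumes E: "eigen_decomp n U x (entries A)" and A: "A \<in> carrier_mat n n"
  defines "V \<equiv> mat n n (\<lambda>(i, j). U i j)"
  shows "V \<in> carrier_mat n n" "unitary_mat V"
    "A = V * mat_diag n (\<lambda>i. complex_of_real (x i)) * mat_adjoint V"
proof -
  show V: "V \<in> carrier_mat n n" by (simp add: V_def)
  note V' = mat_adjoint_carrier[OF V]
  have "mat_adjoint V * V = 1\<^sub>m n"
  proof (rule eq_matI)
    fix i j assume ij: "i < dim_row (1\<^sub>m n)" "j < dim_col (1\<^sub>m n)"
    then have "(mat_adjoint V * V) $$ (i, j) = (\<Sum>k<n. mat_adjoint V $$ (i, k) * V $$ (k, j))"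
      by (intro mat_mult_index[OF V' V]) auto
    also have "\<dots> = (\<Sum>k<n. cnj (U k i) * U k j)"
      using ij by (simp add: mat_adjoint_index[OF V]) (simp add: V_def)
    finally show "(mat_adjoint V * V) $$ (i, j) = 1\<^sub>m n $$ (i, j)"
      using ij by (simp add: unitary_cols[OF eigen_decompD(1)[OF E]])
  qed (use V V' in auto)
  then show "unitary_mat V" using V by (simp add: unitary_mat_def)
  show "A = V * mat_diag n (\<lambda>i. complex_of_real (x i)) * mat_adjoint V"
  proof (rule eq_matI)
    fix i j assume "i < dim_row (V * mat_diag n (\<lambda>i. complex_of_real (x i)) * mat_adjoint V)"
      "j < dim_col (V * mat_diag n (\<lambda>i. complex_of_real (x i)) * mat_adjoint V)"
    then have ij: "i < n" "j < n" using V V' by auto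
    then show "A $$ (i, j) = (V * mat_diag n (\<lambda>i. complex_of_real (x i)) * mat_adjoint V) $$ (i, j)"
      using eigen_decomp_entry[OF E ij]
      by (simp add: unitary_spectral_index[OF V]) (simp add: V_def entries_def)
  qed (use A V V' in auto)
qed

text \<open>\<open>mat_fun\<close> is built from an unspecified decomposition;
  \<open>trace_fun_unique\<close> makes the trace independent of it.\<close>

lemma trace_mat_fun:
  assumes A: "A \<in> carrier_mat n n" and E: "eigen_decomp n U x (entries A)"
  shows "mat_trace (mat_fun f A) = of_real (\<Sum>k<n. f (x k))"
proof -
  let ?P = "\<lambda>C. \<exists>U (d :: nat \<Rightarrow> real). U \<in> carrier_mat (dim_row A) (dim_row A) \<and> unitary_mat U \<and>
     A = U * mat_diag (dim_row A) (\<lambda>i. complex_of_real (d i)) * mat_adjoint U \<and>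
     C = U * mat_diag (dim_row A) (\<lambda>i. complex_of_real (f (d i))) * mat_adjoint U"
  have n: "dim_row A = n" using A by simp
  have "\<exists>C. ?P C" unfolding n using eigen_decomp_to_mat[OF E A] by blast
  then have "?P (mat_fun f A)" unfolding mat_fun_def by (rule someI_ex)
  then obtain V d where V: "V \<in> carrier_mat n n" "unitary_mat V"
    and A': "A = V * mat_diag n (\<lambda>i. complex_of_real (d i)) * mat_adjoint V"
    and C: "mat_fun f A = V * mat_diag n (\<lambda>i. complex_of_real (f (d i))) * mat_adjoint V"
    unfolding n by blast
  note F = eigen_decomp_of_mat[OF V A']
  have "dim_row (mat_fun f A) = n" unfolding C using V by simp
  then have "mat_trace (mat_fun f A) = (\<Sum>i<n. of_real (fdiag n (entries V) d f i))"
    unfolding mat_trace_def fdiag_def entries_def C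
    by (intro sum.cong) (simp_all add: unitary_spectral_index[OF V(1)] complex_norm_square[symmetric] mult.commute
        del: of_real_power)
  also have "\<dots> = of_real (\<Sum>k<n. f (d k))"
    unfolding of_real_sum[symmetric] sum_fdiag[OF eigen_decompD(1)[OF F]] ..
  also have "(\<Sum>k<n. f (d k)) = (\<Sum>k<n. f (x k))" by (rule trace_fun_unique[OF F E])
  finally show ?thesis .
qed

text \<open>A real spectral decomposition makes \<open>A\<close> Hermitian, so
  \<open>mat_adjoint A * A\<close> is the square of \<open>A\<close>.\<close>

lemma eigen_decomp_gram:
  assumes A: "A \<in> carrier_mat n n" and E: "eigen_decomp n U x (entries A)"
  shows "eigen_decomp n U (\<lambda>k. (x k)\<^sup>2) (entries (mat_adjoint A * A))"
proof -
  note U = eigen_decompD[OF E]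
  have "(\<Sum>j<n. entries (mat_adjoint A * A) i j * U j k) = of_real ((x k)\<^sup>2) * U i k"
    if ik: "i < n" "k < n" for i k
  proof -
    have "(\<Sum>j<n. entries (mat_adjoint A * A) i j * U j k)
        = (\<Sum>j<n. \<Sum>m<n. entries A i m * (entries A m j * U j k))"
    proof (rule sum.cong[OF refl])
      fix j assume "j \<in> {..<n}"
      then have j: "j < n" by simp
      have "entries (mat_adjoint A * A) i j = (\<Sum>m<n. mat_adjoint A $$ (i, m) * A $$ (m, j))"
        unfolding entries_def by (rule mat_mult_index[OF mat_adjoint_carrier[OF A] A ik(1) j])
      also have "\<dots> = (\<Sum>m<n. entries A i m * entries A m j)"
        using ik hermD[OF eigen_decomp_herm[OF E]]
        by (intro sum.cong refl) (simp add: mat_adjoint_index[OF A] entries_def)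
      finally show "entries (mat_adjoint A * A) i j * U j k = (\<Sum>m<n. entries A i m * (entries A m j * U j k))"
        by (simp add: sum_distrib_right mult.assoc)
    qed
    also have "\<dots> = (\<Sum>m<n. entries A i m * (\<Sum>j<n. entries A m j * U j k))"
      unfolding sum_distrib_left by (rule sum.swap)
    also have "\<dots> = (\<Sum>m<n. entries A i m * (of_real (x k) * U m k))"
      using U(2) ik by simp
    also have "\<dots> = of_real (x k) * (\<Sum>m<n. entries A i m * U m k)"
      by (simp add: sum_distrib_left mult_ac)
    finally show ?thesis using U(2)[OF ik] by (simp add: power2_eq_square)
  qed
  then show ?thesis using U(1) by (simp add: eigen_decomp_def)
qed

section \<open>Norms and singular values in terms of eigenvalues\<close>

lemma schatten_norm_powr:
  assumes A: "A \<in> carrier_mat n n" and E: "eigen_decomp n U x (entries A)" and p: "0 < p"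
  shows "schatten_norm p A powr p = (\<Sum>k<n. \<bar>x k\<bar> powr p)"
proof -
  have "mat_adjoint A * A \<in> carrier_mat n n" using mat_adjoint_carrier[OF A] A by auto
  from trace_mat_fun[OF this eigen_decomp_gram[OF A E], of "\<lambda>x. x powr (p / 2)"]
  have "Re (mat_trace (mat_powr (mat_adjoint A * A) (p / 2))) = (\<Sum>k<n. (x k)\<^sup>2 powr (p / 2))"
    by (simp add: mat_powr_def)
  also have "\<dots> = (\<Sum>k<n. \<bar>x k\<bar> powr p)"
  proof (rule sum.cong[OF refl])
    fix k
    have "(x k)\<^sup>2 powr (p / 2) = (\<bar>x k\<bar> powr 2) powr (p / 2)" by simp
    then show "(x k)\<^sup>2 powr (p / 2) = \<bar>x k\<bar> powr p" by (simp only: powr_powr) simp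
  qed
  finally show ?thesis
    using p by (simp add: schatten_norm_def powr_powr sum_nonneg)
qed

lemma proots_linear_factors:
  fixes as :: "'a::idom list"
  shows "proots (\<Prod>a\<leftarrow>as. [:- a, 1:]) = mset as"
proof (induction as)
  case (Cons a as)
  have "(\<Prod>a\<leftarrow>as. [:- a, 1:]) \<noteq> 0" by (auto simp: prod_list_zero_iff)
  then have "proots ([:- a, 1:] * (\<Prod>a\<leftarrow>as. [:- a, 1:])) = proots [:- a, 1:] + mset as"
    unfolding Cons.IH[symmetric] by (intro proots_mult) auto
  then show ?case by (simp del: mult_pCons_left)
qed simp

text \<open>The Gram matrix is unitarily similar to the diagonal matrix of the squares, whose
  characteristic polynomial is already factored. The increasing list \<open>x\<close> is read
  backwards because singular values decrease.\<close>

lemma singular_values_eq: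
  assumes A: "A \<in> carrier_mat n n" and E: "eigen_decomp n U x (entries A)"
    and x: "\<And>k. k < n \<Longrightarrow> 0 \<le> x k" and mono: "\<And>i j. i \<le> j \<Longrightarrow> j < n \<Longrightarrow> x i \<le> x j"
  shows "singular_values A = vec n (\<lambda>i. x (n - 1 - i))"
proof -
  define G where "G = mat_adjoint A * A"
  define D where "D = mat_diag n (\<lambda>i. complex_of_real ((x i)\<^sup>2))"
  have G: "G \<in> carrier_mat n n" using mat_adjoint_carrier[OF A] A by (auto simp: G_def)
  define V where "V = mat n n (\<lambda>(i, j). U i j)"
  note V = eigen_decomp_to_mat[OF eigen_decomp_gram[OF A E, folded G_def] G, folded V_def]
  have VV: "mat_adjoint V * V = 1\<^sub>m n" using V by (simp add: unitary_mat_def)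
  have "similar_mat_wit G D V (mat_adjoint V)"
    using V mat_adjoint_carrier[OF V(1)] VV mat_mult_left_right_inverse[OF mat_adjoint_carrier[OF V(1)] V(1) VV] G
    by (auto simp: similar_mat_wit_def D_def)
  then have "char_poly G = char_poly D" by (intro char_poly_similar) (auto simp: similar_mat_def)
  also have "\<dots> = (\<Prod>a\<leftarrow>diag_mat D. [:- a, 1:])"
    by (rule char_poly_upper_triangular[of _ n]) (auto simp: D_def mat_diag_def)
  also have "diag_mat D = map (\<lambda>i. complex_of_real ((x i)\<^sup>2)) [0..<n]"
    by (auto simp: diag_mat_def D_def mat_diag_def)
  finally have "proots (char_poly G) = mset (map (\<lambda>i. complex_of_real ((x i)\<^sup>2)) [0..<n])"
    by (simp only: proots_linear_factors)
  moreover have "map (\<lambda>z. sqrt (Re z)) (map (\<lambda>i. complex_of_real ((x i)\<^sup>2)) [0..<n]) = map x [0..<n]"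
    using x by (simp del: of_real_power)
  ultimately have "image_mset (\<lambda>z. sqrt (Re z)) (proots (char_poly G)) = mset (map x [0..<n])"
    by (simp only: mset_map[symmetric])
  moreover have "sorted (map x [0..<n])" using mono by (auto simp: sorted_iff_nth_mono)
  ultimately have "singular_values A = vec_of_list (rev (map x [0..<n]))"
    by (simp only: singular_values_def G_def sorted_list_of_multiset_mset sorted_sort_id)
  also have "\<dots> = vec n (\<lambda>i. x (n - 1 - i))"
    by (rule eq_vecI) (auto simp: vec_of_list_index rev_nth)
  finally show ?thesis .
qed

lemma vec_pnorm_powr:
  assumes "0 < p"
  shows "vec_pnorm p (vec n (\<lambda>i. x (n - 1 - i))) powr p = (\<Sum>i<n. \<bar>x i\<bar> powr p)"
proof -
  have "(\<Sum>i<n. \<bar>x (n - 1 - i)\<bar> powr p) = (\<Sum>i<n. \<bar>x i\<bar> powr p)"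
    using sum.nat_diff_reindex[of "\<lambda>i. \<bar>x i\<bar> powr p" n] by simp
  then show ?thesis using assms by (simp add: vec_pnorm_def powr_powr sum_nonneg)
qed

section \<open>Change to an eigenbasis of \<open>A\<close>; \<open>conj_by n U M\<close> is the
  matrix of \<open>M\<close> in the basis \<open>U\<close>\<close>

definition conj_by :: "nat \<Rightarrow> cmat \<Rightarrow> cmat \<Rightarrow> cmat" where
  "conj_by n U M i j = (\<Sum>k<n. cnj (U k i) * (\<Sum>l<n. M k l * U l j))"

lemma conj_by_conj_by:
  assumes U: "unitary_fun n U" and ij: "i < n" "j < n"
  shows "conj_by n (\<lambda>i j. cnj (U j i)) (conj_by n U M) i j = M i j"
proof -
  define g where "g = (\<lambda>l m. \<Sum>p<n. M m p * U p l)"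
  have cb: "conj_by n U M k l = coord n U (g l) k" for k l
    by (simp add: conj_by_def coord_def g_def)
  have "conj_by n (\<lambda>i j. cnj (U j i)) (conj_by n U M) i j
      = (\<Sum>k<n. \<Sum>l<n. cnj (U j l) * (U i k * coord n U (g l) k))"
    unfolding conj_by_def[of n "\<lambda>i j. cnj (U j i)"] cb by (simp add: sum_distrib_left mult_ac)
  also have "\<dots> = (\<Sum>l<n. cnj (U j l) * (\<Sum>k<n. U i k * coord n U (g l) k))"
    unfolding sum_distrib_left by (rule sum.swap)
  also have "\<dots> = (\<Sum>l<n. \<Sum>p<n. M i p * (U p l * cnj (U j l)))"
    unfolding unitary_expand[OF U ij(1), symmetric] by (simp add: g_def sum_distrib_left mult_ac)
  also have "\<dots> = (\<Sum>p<n. M i p * (\<Sum>l<n. U p l * cnj (U j l)))"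
    unfolding sum_distrib_left by (rule sum.swap)
  also have "\<dots> = (\<Sum>p<n. M i p * (if p = j then 1 else 0))"
    using ij by (intro sum.cong refl) (simp add: unitary_rows[OF U])
  finally show ?thesis using ij by (simp only: sum_delta_mult)
qed

lemma eigen_decomp_conj_by:
  assumes U: "unitary_fun n U" and E: "eigen_decomp n P x M"
  shows "\<exists>V. eigen_decomp n V x (conj_by n U M)"
proof -
  have U': "unitary_fun n (\<lambda>i j. cnj (U j i))" by (rule unitary_cnj[OF unitary_transpose[OF U]])
  have "eigen_decomp n (\<lambda>i k. \<Sum>j<n. cnj (U j i) * P j k) x (conj_by n U M)"
    by (rule eigen_decomp_conjugate[OF U' E],
        rule conj_by_conj_by[OF U, symmetric, unfolded conj_by_def[of n "\<lambda>i j. cnj (U j i)"]])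
  then show ?thesis by blast
qed

lemma conj_by_eigenbasis:
  assumes E: "eigen_decomp n U a A" and ij: "i < n" "j < n"
  shows "conj_by n U A i j = (if i = j then of_real (a i) else 0)"
proof -
  note U = eigen_decompD[OF E]
  have "conj_by n U A i j = (\<Sum>k<n. cnj (U k i) * (of_real (a j) * U k j))"
    unfolding conj_by_def using U(2) ij by (intro sum.cong refl) simp
  also have "\<dots> = of_real (a j) * (\<Sum>k<n. cnj (U k i) * U k j)"
    by (simp add: sum_distrib_left mult_ac)
  finally show ?thesis using unitary_cols[OF U(1) ij] by simp
qed

text \<open>In an eigenbasis of \<open>A\<close> the matrix \<open>B\<close> becomes
  \<open>M\<close>, and unitary conjugation preserves the eigenvalues of \<open>A + B\<close>,
  \<open>A - B\<close> and \<open>B\<close>. All of these are nonnegative, so the absolute values in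
  the Schatten norms disappear.\<close>

lemma reduction_to_ordered_pair:
  assumes A: "A \<in> carrier_mat n n" and B: "B \<in> carrier_mat n n"
    and hA: "hermitian_mat A" and hB: "hermitian_mat B"
    and AB: "psd_mat (A - B)" and pB: "psd_mat B"
  obtains a b M where "ordered_pair 0 n a b M"
    "singular_values A = vec n (\<lambda>i. a (n - 1 - i))" "singular_values B = vec n (\<lambda>i. b (n - 1 - i))"
    "\<And>p. 0 < p \<Longrightarrow> schatten_norm p (A + B) powr p = trace_fun n (\<lambda>t. t powr p) (diag_plus a M)"
    "\<And>p. 0 < p \<Longrightarrow> schatten_norm p (A - B) powr p = trace_fun n (\<lambda>t. t powr p) (diag_plus a (- M))"
proof -
  have hA': "herm n (entries A)" and hB': "herm n (entries B)"
    by (rule herm_entries[OF A hA] herm_entries[OF B hB])+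
  obtain U a where U: "eigen_decomp n U a (entries A)" and a: "\<And>i j. i \<le> j \<Longrightarrow> j < n \<Longrightarrow> a i \<le> a j"
    using spectral_theorem_sorted[OF hA'] by auto
  obtain P b where P: "eigen_decomp n P b (entries B)" and b: "\<And>i j. i \<le> j \<Longrightarrow> j < n \<Longrightarrow> b i \<le> b j"
    using spectral_theorem_sorted[OF hB'] by auto
  have carrier: "A + B \<in> carrier_mat n n" "A - B \<in> carrier_mat n n" using A B by auto
  have entries_add: "entries (A + B) i j = entries A i j + entries B i j"
    and entries_diff: "entries (A - B) i j = entries A i j - entries B i j" if "i < n" "j < n" for i j
    using A B that by (auto simp: entries_def)
  have "herm n (entries (A + B))" "herm n (entries (A - B))"
    by (rule hermI; simp add: entries_add entries_diff hermD[OF hA'] hermD[OF hB'])+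
  then obtain Q x R y where Q: "eigen_decomp n Q x (entries (A + B))" and R: "eigen_decomp n R y (entries (A - B))"
    using spectral_theorem by metis
  note UU = eigen_decompD(1)[OF U]
  define M where "M = conj_by n U (entries B)"
  have cadd: "conj_by n U (entries (A + B)) i j = conj_by n U (entries A) i j + M i j"
    and cdiff: "conj_by n U (entries (A - B)) i j = conj_by n U (entries A) i j - M i j" for i j
    unfolding M_def conj_by_def
    by (simp_all add: entries_add entries_diff distrib_left distrib_right left_diff_distrib right_diff_distrib
        sum.distrib sum_subtractf)
  obtain V where "eigen_decomp n V x (conj_by n U (entries (A + B)))"
    using eigen_decomp_conj_by[OF UU Q] by blast
  then have V: "eigen_decomp n V x (diag_plus a M)"
    by (rule eigen_decomp_cong) (simp add: cadd conj_by_eigenbasis[OF U] diag_plus_def)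
  obtain W where "eigen_decomp n W y (conj_by n U (entries (A - B)))"
    using eigen_decomp_conj_by[OF UU R] by blast
  then have W: "eigen_decomp n W y (diag_plus a (- M))"
    by (rule eigen_decomp_cong) (simp add: cdiff conj_by_eigenbasis[OF U] diag_plus_def)
  have y: "0 \<le> y k" if "k < n" for k
    using qform_column[OF R that] psd_mat_qform[OF carrier(2) AB] by metis
  have b0: "0 \<le> b k" if "k < n" for k
    using qform_column[OF P that] psd_mat_qform[OF B pB] by metis
  have "0 * (\<Sum>i<n. (cmod (v i))\<^sup>2) \<le> qform n (diag_plus a (- M)) v" for v
    using y by (auto simp: qform_eigen_decomp[OF W] intro!: sum_nonneg)
  then have OP: "ordered_pair 0 n a b M"
    unfolding ordered_pair_def using a b b0 eigen_decomp_conj_by[OF UU P] by (simp add: M_def)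
  \<comment> \<open>\<open>A \<ge> B \<ge> 0\<close> makes the eigenvalues of \<open>A\<close>
    nonnegative, hence equal to its singular values.\<close>
  have a0: "0 \<le> a i" if "i < n" for i
    using ordered_pair_gap[OF OP that] b0[OF that] by simp
  have x: "0 \<le> x k" if "k < n" for k
  proof -
    have "0 \<le> qform n (diag_plus a (- M)) (\<lambda>i. V i k)" "0 \<le> qform n M (\<lambda>i. V i k)"
      using ordered_pairD(5)[OF OP, of "\<lambda>i. V i k"] ordered_pairD(7)[OF OP] by simp_all
    then show ?thesis using qform_column[OF V that] by (simp add: qform_diag_plus qform_uminus)
  qed
  show ?thesis
  proof (rule that[OF OP])
    show "singular_values A = vec n (\<lambda>i. a (n - 1 - i))" by (rule singular_values_eq[OF A U a0 a])
    show "singular_values B = vec n (\<lambda>i. b (n - 1 - i))" by (rule singular_values_eq[OF B P b0 b])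
    fix p :: real assume p: "0 < p"
    show "schatten_norm p (A + B) powr p = trace_fun n (\<lambda>t. t powr p) (diag_plus a M)"
      using x by (simp add: schatten_norm_powr[OF carrier(1) Q p] trace_fun_eq[OF V])
    show "schatten_norm p (A - B) powr p = trace_fun n (\<lambda>t. t powr p) (diag_plus a (- M))"
      using y by (simp add: schatten_norm_powr[OF carrier(2) R p] trace_fun_eq[OF W])
  qed
qed

theorem theorem3p5:
  fixes A B :: "complex mat" and n :: nat
  assumes "A \<in> carrier_mat n n" and "B \<in> carrier_mat n n"
    and "hermitian_mat A" and "hermitian_mat B"
    and "psd_mat (A - B)" and "psd_mat B"
  shows "(\<forall>p::real. 1 \<le> p \<and> p \<le> 2 \<longrightarrow>
            schatten_norm p (A + B) powr p + schatten_norm p (A - B) powr p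
            \<ge> vec_pnorm p (singular_values A + singular_values B) powr p
              + vec_pnorm p (singular_values A - singular_values B) powr p)
       \<and> (\<forall>p::real. 2 \<le> p \<and> p \<le> 3 \<longrightarrow>
            schatten_norm p (A + B) powr p + schatten_norm p (A - B) powr p
            \<le> vec_pnorm p (singular_values A + singular_values B) powr p
              + vec_pnorm p (singular_values A - singular_values B) powr p)
       \<and> ((\<exists>p::real. 1 \<le> p \<and> p \<le> 3 \<and> p \<noteq> 1 \<and> p \<noteq> 2 \<and>
            schatten_norm p (A + B) powr p + schatten_norm p (A - B) powr p
            = vec_pnorm p (singular_values A + singular_values B) powr p
              + vec_pnorm p (singular_values A - singular_values B) powr p)
          \<longleftrightarrow>
          (\<forall>p::real. 1 \<le> p \<and> p \<le> 3 \<longrightarrow>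
            schatten_norm p (A + B) powr p + schatten_norm p (A - B) powr p
            = vec_pnorm p (singular_values A + singular_values B) powr p
              + vec_pnorm p (singular_values A - singular_values B) powr p))"
proof -
  obtain a b M where P: "ordered_pair 0 n a b M"
    and sA: "singular_values A = vec n (\<lambda>i. a (n - 1 - i))"
    and sB: "singular_values B = vec n (\<lambda>i. b (n - 1 - i))"
    and add: "\<And>p. 0 < p \<Longrightarrow> schatten_norm p (A + B) powr p = trace_fun n (\<lambda>t. t powr p) (diag_plus a M)"
    and diff: "\<And>p. 0 < p \<Longrightarrow> schatten_norm p (A - B) powr p = trace_fun n (\<lambda>t. t powr p) (diag_plus a (- M))"
    using reduction_to_ordered_pair[OF assms] by metis
  define L where "L = (\<lambda>p. trace_fun n (\<lambda>t. t powr p) (diag_plus a M) + trace_fun n (\<lambda>t. t powr p) (diag_plus a (- M)))"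
  define S where "S = (\<lambda>p. \<Sum>i<n. (a i + b i) powr p + (a i - b i) powr p)"
  have nonneg: "0 \<le> a i + b i" "0 \<le> a i - b i" if "i < n" for i
    using ordered_pair_gap[OF P that] ordered_pairD(3)[OF P that] by auto
  have lhs: "schatten_norm p (A + B) powr p + schatten_norm p (A - B) powr p = L p" if "1 \<le> p" for p
    using that by (simp add: add diff L_def)
  have rhs: "vec_pnorm p (singular_values A + singular_values B) powr p
      + vec_pnorm p (singular_values A - singular_values B) powr p = S p" if "1 \<le> p" for p
  proof -
    have v: "singular_values A + singular_values B = vec n (\<lambda>i. a (n - 1 - i) + b (n - 1 - i))"
      "singular_values A - singular_values B = vec n (\<lambda>i. a (n - 1 - i) - b (n - 1 - i))"
      unfolding sA sB by (auto intro!: eq_vecI)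
    show ?thesis
      unfolding v
      using that nonneg vec_pnorm_powr[of p n "\<lambda>i. a i + b i"] vec_pnorm_powr[of p n "\<lambda>i. a i - b i"]
      by (simp add: S_def sum.distrib)
  qed
  \<comment> \<open>One statement for both directions: \<open>c = 1\<close> up to 2 and
    \<open>c = -1\<close> from 2 on, as \<open>p * (p - 1) * (p - 2)\<close> changes sign
    there.\<close>
  have ineq: "c * S p \<le> c * L p" if "1 \<le> p" "p \<le> 3" "c * p * (p - 1) * (p - 2) \<le> 0" for c p
  proof -
    have scale: "trace_fun n (\<lambda>t. c * t powr p) N = c * trace_fun n (\<lambda>t. t powr p) N" for N
      by (simp add: trace_fun_def sum_distrib_left)
    show ?thesis
      using trace_inequality_semidefinite[OF P _ that(2,3)] that(1)
      by (simp add: S_def L_def scale sum_distrib_left distrib_left)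
  qed
  have le: "S p \<le> L p" if "1 \<le> p" "p \<le> 2" for p
    using ineq[of p 1] that by (simp add: mult_nonneg_nonpos)
  have ge: "L p \<le> S p" if "2 \<le> p" "p \<le> 3" for p
    using ineq[of p "-1"] that by simp
  have eq: "L p = S p" if "1 < p0" "p0 \<le> 3" "p0 \<noteq> 2" "L p0 = S p0" for p p0
    unfolding L_def S_def
    by (rule trace_fun_eq_if_powr_eq[OF P that(1-3) that(4)[unfolded L_def S_def]])
  have "(\<exists>p. 1 \<le> p \<and> p \<le> 3 \<and> p \<noteq> 1 \<and> p \<noteq> 2 \<and> L p = S p) \<longleftrightarrow> (\<forall>p. 1 \<le> p \<and> p \<le> 3 \<longrightarrow> L p = S p)"
  proof
    assume "\<exists>p. 1 \<le> p \<and> p \<le> 3 \<and> p \<noteq> 1 \<and> p \<noteq> 2 \<and> L p = S p"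
    then obtain p0 where "1 \<le> p0" "p0 \<noteq> 1" "p0 \<le> 3" "p0 \<noteq> 2" "L p0 = S p0" by blast
    then have "1 < p0" "p0 \<le> 3" "p0 \<noteq> 2" "L p0 = S p0" by auto
    then show "\<forall>p. 1 \<le> p \<and> p \<le> 3 \<longrightarrow> L p = S p" using eq by blast
  next
    assume "\<forall>p. 1 \<le> p \<and> p \<le> 3 \<longrightarrow> L p = S p"
    then show "\<exists>p. 1 \<le> p \<and> p \<le> 3 \<and> p \<noteq> 1 \<and> p \<noteq> 2 \<and> L p = S p" by (intro exI[of _ 3]) auto
  qed
  then show ?thesis using le ge by (auto simp: lhs rhs cong: conj_cong imp_cong)
qed

end
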